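(* If $X$ is a strongly pseudoradial space, then the following are equivalent: (1) $X$ is decently strongly pseudoradially compact; (2) $X$ is decently compact.
   Context: A well-ordered space is a well-ordered set with the order topology. If $\alpha$ is a noncompact well-ordered space, $\alpha\cup\{\infty_\alpha\}$ denotes its one-point compactification, obtained by adding a maximal point $\infty_\alpha$ whose basic neighborhoods are $(a,\infty_\alpha]$, $a\in\alpha$. A map is a continuous function. A space $X$ is strongly pseudoradial if for each nonclosed $A\subset X$ there exist a noncompact well-ordered space $\alpha$ and a map $f:\alpha\cup\{\infty_\alpha\}\to X$ with $f(\alpha)\subset A$ and $f(\infty_\alpha)\notin A$. For a noncompact well-ordered space $\alpha$, a map $f:\alpha\to X$ is decent if there exists a map $g_f:\alpha\to X$ such that $g_f(i)\in\overline{\{f(i)\}}$ for all $i\in\alpha$, and $g_f(C)$ is closed in $X$ for all compact $C\subset\alpha$. $X$ is decently strongly pseudoradially compact if for each noncompact well-ordered space $\alpha$ and each decent map $f:\alpha\to X$ there exists $\beta$ closed and cofinal in $\alpha$ such that $f|\beta$ is continuously extendable at $\infty_\alpha$, i.e. extends to a continuous function on the subspace $\beta\cup\{\infty_\alpha\}$ of $\alpha\cup\{\infty_\alpha\}$. $X$ is decently compact if for each noncompact well-ordered space $\alpha$ and each decent map $f:\alpha\to X$ one has $\bigcap_{i\in\alpha}L_i\neq\emptyset$, where $L_i=\overline{\{f(j): j\in\alpha,\ j\geq i\}}$. *)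

theory Defs
  imports "HOL-Analysis.Analysis"
begin

section \<open>Well-ordered spaces\<close>

text \<open>A well-ordered set is a relation \<open>r\<close> with \<open>Well_order r\<close>; its points are \<open>Field r\<close>.
  The member \<open>Field r\<close> of the subbase is only needed when \<open>Field r\<close> is a singleton.\<close>

definition wo_topology :: "'i rel \<Rightarrow> 'i topology" where
  "wo_topology r =
     topology_generated_by (insert (Field r) (underS r ` Field r \<union> aboveS r ` Field r))"

definition noncompact_wo_space :: "'i rel \<Rightarrow> bool" where
  "noncompact_wo_space r \<longleftrightarrow> Well_order r \<and> \<not> compact_space (wo_topology r)"

text \<open>The added point \<open>\<infinity>\<close> is \<open>None\<close>. Lemma \<open>openin_wo_compactification\<close> below
  confirms that its basic neighbourhoods are the sets \<open>(a, \<infinity>]\<close>.\<close>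

abbreviation wo_compactification :: "'i rel \<Rightarrow> 'i option topology" where
  "wo_compactification r \<equiv> Alexandroff_compactification (wo_topology r)"

definition closed_cofinal :: "'i rel \<Rightarrow> 'i set \<Rightarrow> bool" where
  "closed_cofinal r \<beta> \<longleftrightarrow> closedin (wo_topology r) \<beta> \<and> (\<forall>a\<in>Field r. \<exists>b\<in>\<beta>. (a, b) \<in> r)"


section \<open>Decent maps and the three properties\<close>

definition decent_map :: "'i rel \<Rightarrow> 'a topology \<Rightarrow> ('i \<Rightarrow> 'a) \<Rightarrow> bool" where
  "decent_map r X f \<longleftrightarrow>
     continuous_map (wo_topology r) X f \<and>
     (\<exists>g. continuous_map (wo_topology r) X g \<and>
          (\<forall>i\<in>Field r. g i \<in> X closure_of {f i}) \<and>
          (\<forall>C. compactin (wo_topology r) C \<longrightarrow> closedin X (g ` C)))"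

definition extendable_at_infinity :: "'i rel \<Rightarrow> 'a topology \<Rightarrow> ('i \<Rightarrow> 'a) \<Rightarrow> 'i set \<Rightarrow> bool" where
  "extendable_at_infinity r X f \<beta> \<longleftrightarrow>
     (\<exists>F. continuous_map (subtopology (wo_compactification r) (insert None (Some ` \<beta>))) X F \<and>
          (\<forall>b\<in>\<beta>. F (Some b) = f b))"

text \<open>The properties quantify over well-ordered spaces of every size, while a HOL formula
  quantifies over relations on one type. The \<open>_on\<close> versions make that index type \<open>'i\<close> an
  explicit parameter; the properties themselves use \<open>'a + nat\<close>, where \<open>'a\<close> is the type of the
  points of \<open>X\<close>. This loses nothing: the three lemmas at the end of this theory show
  that well-orders on an arbitrary type \<open>'b\<close> give the same notions.\<close>

definition strongly_pseudoradial_on :: "'i itself \<Rightarrow> 'a topology \<Rightarrow> bool" where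
  "strongly_pseudoradial_on (_ :: 'i itself) X \<longleftrightarrow>
     (\<forall>A. A \<subseteq> topspace X \<and> \<not> closedin X A \<longrightarrow>
        (\<exists>(r :: 'i rel) f. noncompact_wo_space r \<and>
           continuous_map (wo_compactification r) X f \<and>
           f ` (Some ` Field r) \<subseteq> A \<and> f None \<notin> A))"

definition decently_strongly_pseudoradially_compact_on :: "'i itself \<Rightarrow> 'a topology \<Rightarrow> bool" where
  "decently_strongly_pseudoradially_compact_on (_ :: 'i itself) X \<longleftrightarrow>
     (\<forall>(r :: 'i rel) f. noncompact_wo_space r \<and> decent_map r X f \<longrightarrow>
        (\<exists>\<beta>. closed_cofinal r \<beta> \<and> extendable_at_infinity r X f \<beta>))"

definition decently_compact_on :: "'i itself \<Rightarrow> 'a topology \<Rightarrow> bool" where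
  "decently_compact_on (_ :: 'i itself) X \<longleftrightarrow>
     (\<forall>(r :: 'i rel) f. noncompact_wo_space r \<and> decent_map r X f \<longrightarrow>
        (\<Inter>i\<in>Field r. X closure_of {f j | j. j \<in> Field r \<and> (i, j) \<in> r}) \<noteq> {})"

definition strongly_pseudoradial :: "'a topology \<Rightarrow> bool" where
  "strongly_pseudoradial X \<longleftrightarrow> strongly_pseudoradial_on TYPE('a + nat) X"

definition decently_strongly_pseudoradially_compact :: "'a topology \<Rightarrow> bool" where
  "decently_strongly_pseudoradially_compact X \<longleftrightarrow>
     decently_strongly_pseudoradially_compact_on TYPE('a + nat) X"

definition decently_compact :: "'a topology \<Rightarrow> bool" where
  "decently_compact X \<longleftrightarrow> decently_compact_on TYPE('a + nat) X"


section \<open>Basic facts on well-ordered spaces\<close>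

lemma wo_refl: "Well_order r \<Longrightarrow> a \<in> Field r \<Longrightarrow> (a, a) \<in> r"
  by (meson wo_rel.REFL wo_rel_def refl_onD)

lemma wo_trans: "Well_order r \<Longrightarrow> (a, b) \<in> r \<Longrightarrow> (b, c) \<in> r \<Longrightarrow> (a, c) \<in> r"
  by (meson wo_rel.TRANS wo_rel_def transD)

lemma wo_antisym: "Well_order r \<Longrightarrow> (a, b) \<in> r \<Longrightarrow> (b, a) \<in> r \<Longrightarrow> a = b"
  by (meson wo_rel.ANTISYM wo_rel_def antisymD)

lemma wo_total: "Well_order r \<Longrightarrow> a \<in> Field r \<Longrightarrow> b \<in> Field r \<Longrightarrow> (a, b) \<in> r \<or> (b, a) \<in> r"
  by (meson wo_rel.TOTALS wo_rel_def)

lemma wo_field: "(a, b) \<in> r \<Longrightarrow> a \<in> Field r \<and> b \<in> Field r"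
  by (auto simp: Field_def)

lemma wo_least:
  assumes "Well_order r" "S \<subseteq> Field r" "S \<noteq> {}"
  obtains m where "m \<in> S" "\<And>s. s \<in> S \<Longrightarrow> (m, s) \<in> r"
  using assms by (meson wo_rel.minim_in wo_rel.minim_least wo_rel_def)

lemma wo_split:
  assumes W: "Well_order r" and a: "a \<in> Field r"
  shows "aboveS r a = Field r - under r a"
proof (intro set_eqI iffI)
  fix x assume "x \<in> aboveS r a"
  then show "x \<in> Field r - under r a"
    using wo_antisym[OF W, of a x] wo_field[of a x r] by (auto simp: aboveS_def under_def)
next
  fix x assume "x \<in> Field r - under r a"
  then show "x \<in> aboveS r a"
    using wo_total[OF W a, of x] wo_refl[OF W a] by (auto simp: aboveS_def under_def)
qed

lemma under_subset_Field: "under r a \<subseteq> Field r"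
  by (auto simp: under_def Field_def)

lemma topspace_wo [simp]: "topspace (wo_topology r) = Field r"
  by (auto simp: wo_topology_def underS_def aboveS_def Field_def)

lemma openin_wo_underS: "openin (wo_topology r) (underS r a)" if "a \<in> Field r"
  unfolding wo_topology_def using that by (intro topology_generated_by_Basis) auto

lemma openin_wo_aboveS: "openin (wo_topology r) (aboveS r a)" if "a \<in> Field r"
  unfolding wo_topology_def using that by (intro topology_generated_by_Basis) auto

lemma openin_wo_under:
  assumes W: "Well_order r" and a: "a \<in> Field r"
  shows "openin (wo_topology r) (under r a)"
proof (cases "aboveS r a = {}")
  case True
  then have "under r a = topspace (wo_topology r)"
    using wo_split[OF W a] under_subset_Field[of r a] by auto
  then show ?thesis
    by (metis openin_topspace)
next
  case False
  have "aboveS r a \<subseteq> Field r"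
    by (auto simp: aboveS_def Field_def)
  then obtain m where m: "m \<in> aboveS r a" "\<And>s. s \<in> aboveS r a \<Longrightarrow> (m, s) \<in> r"
    using wo_least[OF W _ False] by blast
  then have am: "a \<noteq> m" "(a, m) \<in> r" by (auto simp: aboveS_def)
  have "under r a = underS r m"
  proof (intro set_eqI iffI)
    fix x assume "x \<in> under r a"
    then show "x \<in> underS r m"
      using am wo_trans[OF W, of x a m] wo_antisym[OF W, of a m] by (auto simp: under_def underS_def)
  next
    fix x assume x: "x \<in> underS r m"
    show "x \<in> under r a"
    proof (rule ccontr)
      assume "x \<notin> under r a"
      then have "x \<in> aboveS r a"
        using x wo_total[OF W a, of x] wo_refl[OF W a]
        by (auto simp: under_def underS_def aboveS_def dest: wo_field)
      then show False
        using m(2) x wo_antisym[OF W] by (auto simp: underS_def)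
    qed
  qed
  then show ?thesis
    using am openin_wo_underS wo_field by metis
qed

lemma closedin_wo_under:
  assumes W: "Well_order r" and a: "a \<in> Field r"
  shows "closedin (wo_topology r) (under r a)"
proof -
  have "topspace (wo_topology r) - under r a = aboveS r a"
    using wo_split[OF W a] by simp
  then show ?thesis
    using openin_wo_aboveS[OF a] under_subset_Field[of r a] by (simp add: closedin_def)
qed

lemma openin_wo_iff:
  assumes W: "Well_order r"
  shows "openin (wo_topology r) U \<longleftrightarrow>
    U \<subseteq> Field r \<and> (\<forall>a\<in>U. underS r a = {} \<or> (\<exists>b\<in>underS r a. aboveS r b \<inter> under r a \<subseteq> U))"
    (is "_ \<longleftrightarrow> ?R U")
proof
  assume "openin (wo_topology r) U"
  then have "generate_topology_on (insert (Field r) (underS r ` Field r \<union> aboveS r ` Field r)) U"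
    by (simp add: wo_topology_def openin_topology_generated_by_iff)
  then show "?R U"
  proof (induction rule: generate_topology_on.induct)
    case Empty
    then show ?case by auto
  next
    case (Int U V)
    show ?case
    proof (intro conjI ballI)
      show "U \<inter> V \<subseteq> Field r" using Int by blast
      fix a assume a: "a \<in> U \<inter> V"
      show "underS r a = {} \<or> (\<exists>b\<in>underS r a. aboveS r b \<inter> under r a \<subseteq> U \<inter> V)"
      proof (cases "underS r a = {}")
        case False
        obtain b where b: "b \<in> underS r a" "aboveS r b \<inter> under r a \<subseteq> U"
          using Int.IH(1) a False by blast
        obtain c where c: "c \<in> underS r a" "aboveS r c \<inter> under r a \<subseteq> V"
          using Int.IH(2) a False by blast
        have sub: "aboveS r y \<subseteq> aboveS r x" if "(x, y) \<in> r" for x y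
          using that wo_trans[OF W] wo_antisym[OF W] by (auto simp: aboveS_def)
        have "(b, c) \<in> r \<or> (c, b) \<in> r"
          using b c wo_total[OF W, of b c] wo_field[of b a r] wo_field[of c a r]
          by (auto simp: underS_def)
        then show ?thesis
          using b c sub by blast
      qed auto
    qed
  next
    case (UN K)
    show ?case
    proof (intro conjI ballI)
      show "\<Union>K \<subseteq> Field r" using UN by blast
      fix a assume "a \<in> \<Union>K"
      then obtain k where "a \<in> k" "k \<in> K" by blast
      then show "underS r a = {} \<or> (\<exists>b\<in>underS r a. aboveS r b \<inter> under r a \<subseteq> \<Union>K)"
        using UN.IH[of k] by blast
    qed
  next
    case (Basis s)
    then consider "s = Field r" | c where "c \<in> Field r" "s = underS r c"
      | c where "c \<in> Field r" "s = aboveS r c" by auto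
    then show ?case
    proof cases
      case 1
      then show ?thesis by (auto simp: under_def Field_def)
    next
      case 2
      have "under r a \<subseteq> s" if "a \<in> s" for a
        using that 2 wo_trans[OF W, of _ a c] wo_antisym[OF W, of a c]
        by (auto simp: underS_def under_def)
      moreover have "s \<subseteq> Field r" using 2 by (auto simp: underS_def Field_def)
      ultimately show ?thesis by blast
    next
      case 3
      have "c \<in> underS r a" if "a \<in> s" for a
        using that 3 by (auto simp: underS_def aboveS_def)
      moreover have "s \<subseteq> Field r" using 3 by (auto simp: aboveS_def Field_def)
      ultimately show ?thesis using 3 by blast
    qed
  qed
next
  assume R: "?R U"
  show "openin (wo_topology r) U"
  proof (subst openin_subopen, intro ballI)
    fix a assume a: "a \<in> U"
    then have aF: "a \<in> Field r" using R by auto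
    have aa: "a \<in> under r a" using wo_refl[OF W aF] by (simp add: under_def)
    show "\<exists>T. openin (wo_topology r) T \<and> a \<in> T \<and> T \<subseteq> U"
    proof (cases "underS r a = {}")
      case True
      then have "under r a \<subseteq> U" using a by (auto simp: under_def underS_def)
      then show ?thesis using openin_wo_under[OF W aF] aa by blast
    next
      case False
      then obtain b where b: "b \<in> underS r a" "aboveS r b \<inter> under r a \<subseteq> U"
        using R a by blast
      then have "a \<in> aboveS r b" "b \<in> Field r"
        by (auto simp: underS_def aboveS_def Field_def)
      then show ?thesis
        using b openin_Int[OF openin_wo_aboveS openin_wo_under[OF W aF]] aa by blast
    qed
  qed
qed

lemma compactin_wo_under:
  assumes W: "Well_order r"
  shows "compactin (wo_topology r) (under r a)"
proof (cases "a \<in> Field r")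
  case False
  then have "under r a = {}" by (auto simp: under_def Field_def)
  then show ?thesis by simp
next
  case True
  have fin: "\<exists>\<F>. finite \<F> \<and> \<F> \<subseteq> \<U> \<and> under r a \<subseteq> \<Union>\<F>"
    if U: "\<And>U. U \<in> \<U> \<Longrightarrow> openin (wo_topology r) U" and a: "under r a \<subseteq> \<Union>\<U>" for \<U> a
    using a
  proof (induction a rule: wo_rel.well_order_induct[of r])
    case 1
    show ?case using W by (simp add: wo_rel_def)
  next
    case (2 x)
    show ?case
    proof (cases "x \<in> Field r")
      case False
      then have "under r x = {}" by (auto simp: under_def Field_def)
      then show ?thesis by blast
    next
      case True
      then have xx: "x \<in> under r x" using wo_refl[OF W True] by (simp add: under_def)
      then obtain V where V: "V \<in> \<U>" "x \<in> V" using 2 by blast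
      show ?thesis
      proof (cases "underS r x = {}")
        case True
        then have "under r x \<subseteq> \<Union>{V}" using V by (auto simp: under_def underS_def)
        then show ?thesis using V by blast
      next
        case False
        then obtain b where b: "b \<in> underS r x" "aboveS r b \<inter> under r x \<subseteq> V"
          using U[OF V(1)] V(2) openin_wo_iff[OF W] by blast
        have "under r b \<subseteq> under r x"
          using b wo_trans[OF W] by (auto simp: under_def underS_def)
        then have "under r b \<subseteq> \<Union>\<U>" using 2(2) by (rule order.trans)
        moreover have "b \<noteq> x \<and> (b, x) \<in> r" using b(1) by (simp add: underS_def)
        ultimately have "\<exists>\<F>. finite \<F> \<and> \<F> \<subseteq> \<U> \<and> under r b \<subseteq> \<Union>\<F>"
          using 2(1) by simp
        then obtain \<F> where \<F>: "finite \<F>" "\<F> \<subseteq> \<U>" "under r b \<subseteq> \<Union>\<F>"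
          by auto
        have "under r x \<subseteq> under r b \<union> (aboveS r b \<inter> under r x)"
          using b wo_split[OF W, of b] under_subset_Field[of r x] wo_field[of b x r]
          by (auto simp: underS_def)
        then have "under r x \<subseteq> \<Union>(insert V \<F>)" using b \<F> by blast
        then show ?thesis using \<F> V by (metis finite_insert insert_subset)
      qed
    qed
  qed
  show ?thesis
    unfolding compactin_def using fin by (auto simp: under_def Field_def)
qed

lemma compactin_wo_bounded:
  assumes W: "Well_order r" and C: "compactin (wo_topology r) C" and ne: "Field r \<noteq> {}"
  shows "\<exists>a\<in>Field r. C \<subseteq> under r a"
proof -
  have CF: "C \<subseteq> Field r" using compactin_subset_topspace[OF C] by simp
  then have "C \<subseteq> \<Union>(under r ` Field r)"
    using wo_refl[OF W] by (auto simp: under_def)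
  moreover have "openin (wo_topology r) U" if "U \<in> under r ` Field r" for U
    using that openin_wo_under[OF W] by auto
  ultimately obtain \<F> where \<F>: "finite \<F>" "\<F> \<subseteq> under r ` Field r" "C \<subseteq> \<Union>\<F>"
    using compactinD[OF C, of "under r ` Field r"] by auto
  obtain A where A: "finite A" "A \<subseteq> Field r" "\<F> = under r ` A"
    using finite_subset_image[OF \<F>(1,2)] by auto
  have "\<exists>a\<in>Field r. \<forall>b\<in>A. (b, a) \<in> r"
    using A(1,2)
  proof (induction rule: finite_induct)
    case empty
    then show ?case using ne by auto
  next
    case (insert x F)
    then obtain a where a: "a \<in> Field r" "\<forall>b\<in>F. (b, a) \<in> r" and x: "x \<in> Field r"
      by auto
    show ?case
    proof (cases "(a, x) \<in> r")
      case True
      then have "\<forall>b\<in>insert x F. (b, x) \<in> r"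
        using a wo_trans[OF W] wo_refl[OF W x] by auto
      then show ?thesis using x by auto
    next
      case False
      then have "(x, a) \<in> r" using wo_total[OF W a(1) x] by auto
      then show ?thesis using a by auto
    qed
  qed
  then obtain a where a: "a \<in> Field r" "\<forall>b\<in>A. (b, a) \<in> r" by auto
  have "C \<subseteq> under r a"
  proof
    fix c assume "c \<in> C"
    then obtain b where "b \<in> A" "(c, b) \<in> r"
      using \<F>(3) A(3) by (auto simp: under_def)
    then show "c \<in> under r a" using a wo_trans[OF W, of c b a] by (auto simp: under_def)
  qed
  then show ?thesis using a by auto
qed

lemma noncompact_wo_space_iff:
  "noncompact_wo_space r \<longleftrightarrow> Well_order r \<and> Field r \<noteq> {} \<and> (\<forall>a\<in>Field r. aboveS r a \<noteq> {})"
proof -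
  have "compact_space (wo_topology r) \<longleftrightarrow> Field r = {} \<or> (\<exists>a\<in>Field r. aboveS r a = {})"
    if W: "Well_order r"
  proof
    assume "compact_space (wo_topology r)"
    then have "compactin (wo_topology r) (Field r)" by (simp add: compact_space_def)
    moreover have "aboveS r a = {}" if "Field r \<subseteq> under r a" for a
      using that wo_split[OF W, of a] by (cases "a \<in> Field r") (auto simp: aboveS_def Field_def)
    ultimately show "Field r = {} \<or> (\<exists>a\<in>Field r. aboveS r a = {})"
      using compactin_wo_bounded[OF W] by blast
  next
    assume R: "Field r = {} \<or> (\<exists>a\<in>Field r. aboveS r a = {})"
    have "under r a = Field r" if "a \<in> Field r" "aboveS r a = {}" for a
      using that wo_split[OF W] under_subset_Field[of r a] by blast
    then show "compact_space (wo_topology r)"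
      using R compactin_wo_under[OF W] by (metis compact_space_def compactin_empty topspace_wo)
  qed
  then show ?thesis by (auto simp: noncompact_wo_space_def)
qed

lemma openin_wo_compactification:
  assumes N: "noncompact_wo_space r"
  shows "openin (wo_compactification r) U \<longleftrightarrow>
    U \<subseteq> insert None (Some ` Field r) \<and> openin (wo_topology r) {x. Some x \<in> U} \<and>
    (None \<in> U \<longrightarrow> (\<exists>a\<in>Field r. insert None (Some ` aboveS r a) \<subseteq> U))"
    (is "_ \<longleftrightarrow> ?R")
proof
  have W: "Well_order r" and ne: "Field r \<noteq> {}"
    using N noncompact_wo_space_iff by blast+
  show ?R if U: "openin (wo_compactification r) U"
  proof (intro conjI impI)
    show "U \<subseteq> insert None (Some ` Field r)"
      using openin_subset[OF U] by simp
    then have "{x. Some x \<in> U} = {x \<in> topspace (wo_topology r). Some x \<in> U}" by auto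
    then show "openin (wo_topology r) {x. Some x \<in> U}"
      using openin_continuous_map_preimage[OF continuous_map_Some U] by simp
    assume "None \<in> U"
    then obtain C where C: "compactin (wo_topology r) C" "U = insert None (Some ` (Field r - C))"
      using U by (auto simp: openin_Alexandroff_compactification)
    then obtain a where a: "a \<in> Field r" "C \<subseteq> under r a"
      using compactin_wo_bounded[OF W _ ne] by blast
    then have "aboveS r a \<subseteq> Field r - C"
      using wo_split[OF W] by blast
    then show "\<exists>a\<in>Field r. insert None (Some ` aboveS r a) \<subseteq> U"
      using a C by blast
  qed
  assume R: ?R
  show "openin (wo_compactification r) U"
  proof (cases "None \<in> U")
    case False
    then have "U = Some ` {x. Some x \<in> U}" using R by auto
    then show ?thesis using R by (metis openin_Alexandroff_compactification_image_Some)
  next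
    case True
    then obtain a where a: "a \<in> Field r" "Some ` aboveS r a \<subseteq> U" using R by auto
    define C where "C = Field r - {x. Some x \<in> U}"
    have cl: "closedin (wo_topology r) C"
      using R C_def by (metis closedin_diff closedin_topspace topspace_wo)
    have "C \<subseteq> under r a"
      using a wo_split[OF W a(1)] by (auto simp: C_def)
    then have "compactin (wo_topology r) C"
      using closed_compactin[OF compactin_wo_under[OF W]] cl by blast
    moreover have "U = insert None (Some ` (Field r - C))"
      using R True by (auto simp: C_def)
    ultimately show ?thesis
      using cl by (auto simp: openin_Alexandroff_compactification)
  qed
qed


section \<open>Restriction to closed cofinal subsets\<close>

text \<open>\<open>h\<close> is an order isomorphism from \<open>r'\<close> onto a closed cofinal subset of \<open>r\<close>.\<close>

locale wo_restriction =
  fixes r :: "'b rel" and r' :: "'c rel" and h :: "'c \<Rightarrow> 'b"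
  assumes N: "noncompact_wo_space r"
    and W': "Well_order r'"
    and h_into: "h ` Field r' \<subseteq> Field r"
    and h_ord: "\<And>x y. x \<in> Field r' \<Longrightarrow> y \<in> Field r' \<Longrightarrow> (h x, h y) \<in> r \<longleftrightarrow> (x, y) \<in> r'"
    and h_closed_cofinal: "closed_cofinal r (h ` Field r')"
begin

definition k :: "'b \<Rightarrow> 'c" where "k = inv_into (Field r') h"

lemma W: "Well_order r"
  using N by (simp add: noncompact_wo_space_def)

lemma h_Field: "x \<in> Field r' \<Longrightarrow> h x \<in> Field r"
  using h_into by auto

lemma inj: "inj_on h (Field r')"
  using h_ord h_Field wo_refl[OF W] wo_antisym[OF W'] by (metis inj_onI)

lemma k_h: "x \<in> Field r' \<Longrightarrow> k (h x) = x"
  by (simp add: k_def inj)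

lemma cofinal: "a \<in> Field r \<Longrightarrow> \<exists>x\<in>Field r'. (a, h x) \<in> r"
  using h_closed_cofinal by (auto simp: closed_cofinal_def)

lemma closed: "closedin (wo_topology r) (h ` Field r')"
  using h_closed_cofinal by (auto simp: closed_cofinal_def)

lemma h_less: "x \<in> Field r' \<Longrightarrow> y \<in> Field r' \<Longrightarrow> h y \<in> aboveS r (h x) \<longleftrightarrow> y \<in> aboveS r' x"
  using h_ord inj by (auto simp: aboveS_def inj_on_def)

lemma N': "noncompact_wo_space r'"
proof -
  have ne: "Field r \<noteq> {}" and up: "\<And>a. a \<in> Field r \<Longrightarrow> aboveS r a \<noteq> {}"
    using N by (auto simp: noncompact_wo_space_iff)
  have "aboveS r' x \<noteq> {}" if x: "x \<in> Field r'" for x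
  proof -
    obtain b where b: "b \<in> aboveS r (h x)" using up h_Field[OF x] by blast
    then have bF: "b \<in> Field r" using wo_split[OF W h_Field[OF x]] by blast
    then obtain y where y: "y \<in> Field r'" "(b, h y) \<in> r" using cofinal by blast
    have "h y \<in> aboveS r (h x)"
      using b y wo_trans[OF W, of "h x" b "h y"] wo_antisym[OF W, of "h x" b] by (auto simp: aboveS_def)
    then show ?thesis using h_less[OF x y(1)] by auto
  qed
  moreover have "Field r' \<noteq> {}" using ne cofinal by blast
  ultimately show ?thesis using W' by (simp add: noncompact_wo_space_iff)
qed

lemma continuous_h: "continuous_map (wo_topology r') (wo_topology r) h"
  unfolding continuous_map_def
proof (intro conjI allI impI)
  show "h \<in> topspace (wo_topology r') \<rightarrow> topspace (wo_topology r)" using h_Field by auto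
  fix U assume U: "openin (wo_topology r) U"
  show "openin (wo_topology r') {x \<in> topspace (wo_topology r'). h x \<in> U}"
    unfolding openin_wo_iff[OF W'] topspace_wo
  proof (intro conjI ballI)
    fix x assume "x \<in> {x \<in> Field r'. h x \<in> U}"
    then have x: "x \<in> Field r'" "h x \<in> U" by auto
    show "underS r' x = {} \<or> (\<exists>b\<in>underS r' x. aboveS r' b \<inter> under r' x \<subseteq> {x \<in> Field r'. h x \<in> U})"
    proof (cases "underS r' x = {}")
      case False
      then obtain y0 where y0: "y0 \<in> underS r' x" by auto
      have uF: "y \<in> Field r'" if "y \<in> underS r' x" for y
        using that by (auto simp: underS_def Field_def)
      have hu: "h y \<in> underS r (h x)" if "y \<in> underS r' x" for y
        using that h_ord[OF uF[OF that] x(1)] inj uF[OF that] x(1)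
        by (auto simp: underS_def inj_on_def)
      obtain b where b: "b \<in> underS r (h x)" "aboveS r b \<inter> under r (h x) \<subseteq> U"
        using U x(2) hu[OF y0] unfolding openin_wo_iff[OF W] by blast
      have bF: "b \<in> Field r" using b by (auto simp: underS_def Field_def)
      show ?thesis
      proof (cases "\<exists>y\<in>underS r' x. (b, h y) \<in> r")
        case True
        then obtain y where y: "y \<in> underS r' x" "(b, h y) \<in> r" by auto
        have "h z \<in> U" if z: "z \<in> aboveS r' y \<inter> under r' x" for z
        proof -
          have zF: "z \<in> Field r'" using z by (auto simp: under_def Field_def)
          have 1: "h z \<in> aboveS r (h y)" using h_less[OF uF[OF y(1)] zF] z by auto
          then have "h z \<in> aboveS r b"
            using y(2) wo_trans[OF W, of b "h y" "h z"] wo_antisym[OF W, of "h y" "h z"]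
            by (auto simp: aboveS_def)
          moreover have "h z \<in> under r (h x)"
            using z h_ord[OF zF x(1)] by (auto simp: under_def)
          ultimately show ?thesis using b(2) by blast
        qed
        moreover have "z \<in> Field r'" if "z \<in> under r' x" for z
          using that by (auto simp: under_def Field_def)
        ultimately show ?thesis using y(1) by blast
      next
        case False
        define B where "B = {c \<in> Field r. \<forall>y\<in>underS r' x. (h y, c) \<in> r}"
        have "b \<in> B"
          using False bF wo_total[OF W bF h_Field] uF by (auto simp: B_def)
        then obtain c where c: "c \<in> B" "\<And>d. d \<in> B \<Longrightarrow> (c, d) \<in> r"
          using wo_least[OF W, of B] B_def by blast
        have cF: "c \<in> Field r" and cub: "\<And>y. y \<in> underS r' x \<Longrightarrow> (h y, c) \<in> r"
          using c(1) by (auto simp: B_def)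
        have "c \<in> h ` Field r'"
        proof (rule ccontr)
          assume nc: "c \<notin> h ` Field r'"
          have "openin (wo_topology r) (Field r - h ` Field r')"
            using closed by (simp add: closedin_def)
          moreover have "underS r c \<noteq> {}"
            using cub[OF y0] nc uF[OF y0] by (auto simp: underS_def)
          ultimately obtain d where d: "d \<in> underS r c" "aboveS r d \<inter> under r c \<subseteq> Field r - h ` Field r'"
            using nc cF unfolding openin_wo_iff[OF W] by blast
          have dF: "d \<in> Field r" using d by (auto simp: underS_def Field_def)
          have "d \<notin> B" using c(2) d(1) wo_antisym[OF W] by (auto simp: underS_def)
          then obtain y where y: "y \<in> underS r' x" "(h y, d) \<notin> r" using dF by (auto simp: B_def)
          then have "h y \<in> aboveS r d"
            using wo_split[OF W dF] h_Field[OF uF[OF y(1)]] by (auto simp: under_def)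
          then show False
            using d(2) cub[OF y(1)] uF[OF y(1)] by (auto simp: under_def)
        qed
        then obtain z where z: "z \<in> Field r'" "c = h z" by auto
        have "(c, b) \<in> r" using c(2) \<open>b \<in> B\<close> by auto
        then have "c \<in> underS r (h x)"
          using b(1) wo_trans[OF W, of c b "h x"] wo_antisym[OF W, of c b] by (auto simp: underS_def)
        then have zx: "z \<in> underS r' x"
          using z h_ord[OF z(1) x(1)] by (auto simp: underS_def)
        have "w = x" if w: "w \<in> aboveS r' z \<inter> under r' x" for w
        proof (rule ccontr)
          assume "w \<noteq> x"
          then have wu: "w \<in> underS r' x" using w by (auto simp: underS_def under_def)
          then have "(w, z) \<in> r'" using cub h_ord[OF uF[OF wu] z(1)] z(2) by auto
          then show False using w wo_antisym[OF W', of w z] by (auto simp: aboveS_def)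
        qed
        then have "aboveS r' z \<inter> under r' x \<subseteq> {x \<in> Field r'. h x \<in> U}" using x by blast
        then show ?thesis using zx by blast
      qed
    qed simp
  qed auto
qed

lemma continuous_k:
  "continuous_map (subtopology (wo_topology r) (h ` Field r')) (wo_topology r') k"
  unfolding wo_topology_def[of r']
proof (rule continuous_on_generated_topo)
  have ts: "topspace (subtopology (wo_topology r) (h ` Field r')) = h ` Field r'"
    using h_into by auto
  show "k ` topspace (subtopology (wo_topology r) (h ` Field r'))
      \<subseteq> \<Union> (insert (Field r') (underS r' ` Field r' \<union> aboveS r' ` Field r'))"
    unfolding ts using k_h by auto
  fix U assume "U \<in> insert (Field r') (underS r' ` Field r' \<union> aboveS r' ` Field r')"
  then consider "U = Field r'" | x where "x \<in> Field r'" "U = underS r' x"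
    | x where "x \<in> Field r'" "U = aboveS r' x" by auto
  then have "\<exists>T. openin (wo_topology r) T \<and> k -` U \<inter> h ` Field r' = T \<inter> h ` Field r'"
  proof cases
    case 1
    then have "k -` U \<inter> h ` Field r' = Field r \<inter> h ` Field r'"
      using k_h h_into by auto
    then show ?thesis using openin_topspace[of "wo_topology r"] by auto
  next
    case 2
    have "y \<in> underS r' x \<longleftrightarrow> h y \<in> underS r (h x)" if "y \<in> Field r'" for y
      using h_ord[OF that 2(1)] inj that 2(1) by (auto simp: underS_def inj_on_def)
    then have "k -` U \<inter> h ` Field r' = underS r (h x) \<inter> h ` Field r'"
      using k_h 2 by auto
    then show ?thesis using openin_wo_underS[OF h_Field[OF 2(1)]] by blast
  next
    case 3
    then have "k -` U \<inter> h ` Field r' = aboveS r (h x) \<inter> h ` Field r'"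
      using k_h h_less[OF 3(1)] by auto
    then show ?thesis using openin_wo_aboveS[OF h_Field[OF 3(1)]] by blast
  qed
  then show "openin (subtopology (wo_topology r) (h ` Field r'))
      (k -` U \<inter> topspace (subtopology (wo_topology r) (h ` Field r')))"
    unfolding ts openin_subtopology by blast
qed

lemma continuous_h_compactification:
  "continuous_map (wo_compactification r') (wo_compactification r) (map_option h)"
  unfolding continuous_map_def
proof (intro conjI allI impI)
  show "map_option h \<in> topspace (wo_compactification r') \<rightarrow> topspace (wo_compactification r)"
    using h_Field by auto
  fix U assume "openin (wo_compactification r) U"
  then have U: "openin (wo_topology r) {x. Some x \<in> U}"
      "None \<in> U \<Longrightarrow> \<exists>a\<in>Field r. insert None (Some ` aboveS r a) \<subseteq> U"
    using openin_wo_compactification[OF N] by auto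
  let ?P = "{x \<in> topspace (wo_compactification r'). map_option h x \<in> U}"
  have "openin (wo_topology r') {x \<in> topspace (wo_topology r'). h x \<in> {x. Some x \<in> U}}"
    using openin_continuous_map_preimage[OF continuous_h U(1)] .
  moreover have "{x \<in> topspace (wo_topology r'). h x \<in> {x. Some x \<in> U}} = {x. Some x \<in> ?P}"
    by auto
  ultimately have 1: "openin (wo_topology r') {x. Some x \<in> ?P}" by simp
  have 2: "\<exists>a\<in>Field r'. insert None (Some ` aboveS r' a) \<subseteq> ?P" if "None \<in> ?P"
  proof -
    have "None \<in> U" using that by simp
    then obtain a where a: "a \<in> Field r" "insert None (Some ` aboveS r a) \<subseteq> U"
      using U(2) by blast
    obtain x where x: "x \<in> Field r'" "(a, h x) \<in> r" using cofinal[OF a(1)] by auto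
    have "h y \<in> aboveS r a" "y \<in> Field r'" if y: "y \<in> aboveS r' x" for y
    proof -
      show yF: "y \<in> Field r'" using y by (auto simp: aboveS_def Field_def)
      show "h y \<in> aboveS r a"
        using h_less[OF x(1) yF] y x(2) wo_trans[OF W, of a "h x" "h y"] wo_antisym[OF W, of "h x" "h y"]
        by (auto simp: aboveS_def)
    qed
    then have "insert None (Some ` aboveS r' x) \<subseteq> ?P" using a(2) by auto
    then show ?thesis using x(1) by blast
  qed
  show "openin (wo_compactification r') ?P"
    unfolding openin_wo_compactification[OF N'] using 1 2 by auto
qed

lemma continuous_k_compactification:
  "continuous_map (subtopology (wo_compactification r) (insert None (Some ` h ` Field r')))
     (wo_compactification r') (map_option k)"
proof -
  let ?S = "insert None (Some ` h ` Field r')"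
  have ts: "topspace (subtopology (wo_compactification r) ?S) = ?S"
    using h_into by auto
  show ?thesis
    unfolding continuous_map_def ts
  proof (intro conjI allI impI)
    show "map_option k \<in> ?S \<rightarrow> topspace (wo_compactification r')"
      using k_h by auto
    fix V assume "openin (wo_compactification r') V"
    then have V: "openin (wo_topology r') {x. Some x \<in> V}"
        "None \<in> V \<Longrightarrow> \<exists>a\<in>Field r'. insert None (Some ` aboveS r' a) \<subseteq> V"
      using openin_wo_compactification[OF N'] by auto
    have "topspace (subtopology (wo_topology r) (h ` Field r')) = h ` Field r'"
      using h_into by auto
    then have "openin (subtopology (wo_topology r) (h ` Field r')) {b \<in> h ` Field r'. Some (k b) \<in> V}"
      using openin_continuous_map_preimage[OF continuous_k V(1)] by simp
    then obtain T0 where T0: "openin (wo_topology r) T0"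
        "{b \<in> h ` Field r'. Some (k b) \<in> V} = T0 \<inter> h ` Field r'"
      unfolding openin_subtopology by blast
    have T0m: "b \<in> T0 \<longleftrightarrow> Some (k b) \<in> V" if "b \<in> h ` Field r'" for b
      using T0(2) that by blast
    have T0F: "T0 \<subseteq> Field r" using openin_subset[OF T0(1)] by simp
    show "openin (subtopology (wo_compactification r) ?S) {z \<in> ?S. map_option k z \<in> V}"
    proof (cases "None \<in> V")
      case False
      then have "{z \<in> ?S. map_option k z \<in> V} = Some ` T0 \<inter> ?S"
        using T0m by auto
      moreover have "openin (wo_compactification r) (Some ` T0)" using T0(1) by simp
      ultimately show ?thesis unfolding openin_subtopology by blast
    next
      case True
      then obtain a where a: "a \<in> Field r'" "insert None (Some ` aboveS r' a) \<subseteq> V" using V(2) by auto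
      define T where "T = insert None (Some ` (T0 \<union> aboveS r (h a)))"
      have aF: "h a \<in> Field r" using h_Field a(1) .
      have "{x. Some x \<in> T} = T0 \<union> aboveS r (h a)" by (auto simp: T_def)
      then have "openin (wo_topology r) {x. Some x \<in> T}"
        using T0(1) openin_wo_aboveS[OF aF] by auto
      moreover have "T \<subseteq> insert None (Some ` Field r)"
        using T0F wo_split[OF W aF] by (auto simp: T_def)
      ultimately have "openin (wo_compactification r) T"
        unfolding openin_wo_compactification[OF N] using aF by (auto simp: T_def)
      moreover have "{z \<in> ?S. map_option k z \<in> V} = T \<inter> ?S"
      proof -
        have "Some (k b) \<in> V" if b: "b \<in> h ` Field r'" "b \<in> aboveS r (h a)" for b
        proof -
          obtain y where y: "y \<in> Field r'" "b = h y" using b by auto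
          then have "y \<in> aboveS r' a" using b h_less[OF a(1) y(1)] by auto
          then show ?thesis using a(2) y k_h by auto
        qed
        then show ?thesis using T0m True by (auto simp: T_def)
      qed
      ultimately show ?thesis unfolding openin_subtopology by blast
    qed
  qed
qed

lemma decent_h:
  assumes "decent_map r X f"
  shows "decent_map r' X (f \<circ> h)"
proof -
  obtain g where f: "continuous_map (wo_topology r) X f"
    and g: "continuous_map (wo_topology r) X g" "\<And>i. i \<in> Field r \<Longrightarrow> g i \<in> X closure_of {f i}"
      "\<And>C. compactin (wo_topology r) C \<Longrightarrow> closedin X (g ` C)"
    using assms unfolding decent_map_def by blast
  have "closedin X ((g \<circ> h) ` C)" if "compactin (wo_topology r') C" for C
    using g(3)[OF image_compactin[OF that continuous_h]] by (simp add: image_comp)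
  then show ?thesis
    unfolding decent_map_def
    using continuous_map_compose[OF continuous_h f] continuous_map_compose[OF continuous_h g(1)]
      g(2) h_Field by (intro conjI exI[of _ "g \<circ> h"]) auto
qed

lemma closed_cofinal_h:
  assumes "closed_cofinal r' \<beta>"
  shows "closed_cofinal r (h ` \<beta>)"
proof -
  have cl: "closedin (wo_topology r') \<beta>" and cof: "\<And>a. a \<in> Field r' \<Longrightarrow> \<exists>b\<in>\<beta>. (a, b) \<in> r'"
    using assms by (auto simp: closed_cofinal_def)
  have sub: "\<beta> \<subseteq> Field r'" using closedin_subset[OF cl] by simp
  have "closedin (subtopology (wo_topology r) (h ` Field r'))
     {b \<in> topspace (subtopology (wo_topology r) (h ` Field r')). k b \<in> \<beta>}"
    using closedin_continuous_map_preimage[OF continuous_k cl] .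
  moreover have "{b \<in> topspace (subtopology (wo_topology r) (h ` Field r')). k b \<in> \<beta>} = h ` \<beta>"
    using sub k_h h_into by auto
  ultimately have "closedin (wo_topology r) (h ` \<beta>)"
    using closedin_trans_full closed by fastforce
  moreover have "\<exists>b\<in>h ` \<beta>. (a, b) \<in> r" if a: "a \<in> Field r" for a
  proof -
    obtain x where x: "x \<in> Field r'" "(a, h x) \<in> r" using cofinal[OF a] by auto
    obtain b where b: "b \<in> \<beta>" "(x, b) \<in> r'" using cof[OF x(1)] by auto
    then have "(h x, h b) \<in> r" using h_ord x(1) sub by blast
    then show ?thesis using x b wo_trans[OF W] by blast
  qed
  ultimately show ?thesis by (simp add: closed_cofinal_def)
qed

lemma extendable_h:
  assumes "extendable_at_infinity r' X (f \<circ> h) \<beta>" and sub: "\<beta> \<subseteq> Field r'"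
  shows "extendable_at_infinity r X f (h ` \<beta>)"
proof -
  obtain F where F: "continuous_map (subtopology (wo_compactification r') (insert None (Some ` \<beta>))) X F"
    "\<And>b. b \<in> \<beta> \<Longrightarrow> F (Some b) = f (h b)"
    using assms(1) by (auto simp: extendable_at_infinity_def)
  have "continuous_map (subtopology (wo_compactification r) (insert None (Some ` h ` \<beta>)))
     (wo_compactification r') (map_option k)"
    by (rule continuous_map_from_subtopology_mono[OF continuous_k_compactification]) (use sub in blast)
  then have "continuous_map (subtopology (wo_compactification r) (insert None (Some ` h ` \<beta>)))
     (subtopology (wo_compactification r') (insert None (Some ` \<beta>))) (map_option k)"
    using sub k_h by (auto simp: continuous_map_in_subtopology)
  then have "continuous_map (subtopology (wo_compactification r) (insert None (Some ` h ` \<beta>))) X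
      (F \<circ> map_option k)"
    using F(1) continuous_map_compose by blast
  moreover have "(F \<circ> map_option k) (Some b) = f b" if "b \<in> h ` \<beta>" for b
    using that F(2) k_h sub by auto
  ultimately show ?thesis unfolding extendable_at_infinity_def by blast
qed

end


section \<open>Independence of the index type\<close>

text \<open>If \<open>S\<close> is cofinal, then its closure is no larger than \<open>S\<close>, so it can be
  copied to any infinite type into which \<open>S\<close> injects.\<close>

lemma restriction_exists:
  fixes r :: "'b rel" and e :: "'b \<Rightarrow> 'u"
  assumes N: "noncompact_wo_space r" and S: "S \<subseteq> Field r" and e: "inj_on e S"
    and cof: "\<And>a. a \<in> Field r \<Longrightarrow> \<exists>s\<in>S. (a, s) \<in> r"
    and inf: "infinite (UNIV :: 'u set)"
  shows "\<exists>(r' :: 'u rel) h. wo_restriction r r' h"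
proof -
  have W: "Well_order r" using N by (simp add: noncompact_wo_space_def)
  define T where "T = wo_topology r closure_of S"
  have clT: "closedin (wo_topology r) T" by (simp add: T_def)
  have ST: "S \<subseteq> T" unfolding T_def using S by (simp add: closure_of_subset)
  have TF: "T \<subseteq> Field r" using closedin_subset[OF clT] by simp
  define n where "n c = (SOME s. s \<in> S \<and> (c, s) \<in> r \<and> (\<forall>t\<in>S. (c, t) \<in> r \<longrightarrow> (s, t) \<in> r))" for c
  have n: "n c \<in> S \<and> (c, n c) \<in> r \<and> (\<forall>t\<in>S. (c, t) \<in> r \<longrightarrow> (n c, t) \<in> r)" if "c \<in> Field r" for c
  proof -
    have "{s \<in> S. (c, s) \<in> r} \<subseteq> Field r" "{s \<in> S. (c, s) \<in> r} \<noteq> {}"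
      using S cof[OF that] by auto
    then obtain m where "m \<in> {s \<in> S. (c, s) \<in> r}" "\<And>s. s \<in> {s \<in> S. (c, s) \<in> r} \<Longrightarrow> (m, s) \<in> r"
      by (rule wo_least[OF W]) blast
    then have "\<exists>s. s \<in> S \<and> (c, s) \<in> r \<and> (\<forall>t\<in>S. (c, t) \<in> r \<longrightarrow> (s, t) \<in> r)" by auto
    then show ?thesis unfolding n_def by (rule someI_ex)
  qed
  have lt: "n c \<noteq> n d" if c: "c \<in> T - S" and d: "d \<in> T - S" and cd: "(c, d) \<in> r" "c \<noteq> d" for c d
  proof
    assume eq: "n c = n d"
    have cF: "c \<in> Field r" and dF: "d \<in> Field r" using c d TF by auto
    have "openin (wo_topology r) (aboveS r c \<inter> under r d)"
      using openin_wo_aboveS[OF cF] openin_wo_under[OF W dF] by blast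
    moreover have "d \<in> aboveS r c \<inter> under r d"
      using cd wo_refl[OF W dF] by (auto simp: aboveS_def under_def)
    ultimately obtain s where s: "s \<in> S" "s \<in> aboveS r c" "s \<in> under r d"
      using d unfolding T_def by (auto simp: in_closure_of)
    then have "(n c, s) \<in> r" using n[OF cF] by (auto simp: aboveS_def)
    moreover have "(d, n d) \<in> r" using n[OF dF] by auto
    ultimately have "(d, s) \<in> r" using eq wo_trans[OF W] by metis
    then have "s = d" using s wo_antisym[OF W] by (auto simp: under_def)
    then show False using s d by auto
  qed
  have "inj_on n (T - S)"
  proof (rule inj_onI, rule ccontr)
    fix c d assume a: "c \<in> T - S" "d \<in> T - S" "n c = n d" "c \<noteq> d"
    have "(c, d) \<in> r \<or> (d, c) \<in> r" using a TF wo_total[OF W] by blast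
    then show False using a lt[of c d] lt[of d c] by auto
  qed
  moreover have "n ` (T - S) \<subseteq> S" using n TF by auto
  ultimately have "inj_on (e \<circ> n) (T - S)"
    using e by (intro comp_inj_on) (auto intro: inj_on_subset)
  then have 1: "(card_of (T - S), card_of (UNIV :: 'u set)) \<in> ordLeq"
    using card_of_ordLeq[of "T - S" "UNIV :: 'u set"] by blast
  have 2: "(card_of S, card_of (UNIV :: 'u set)) \<in> ordLeq"
    using card_of_ordLeq[of S "UNIV :: 'u set"] e by blast
  have "(card_of ((T - S) \<union> S), card_of (UNIV :: 'u set)) \<in> ordLeq"
    by (rule card_of_Un_ordLeq_infinite_Field[OF _ 1 2]) (simp add: inf Field_card_of, rule card_of_Card_order)
  moreover have "(T - S) \<union> S = T" using ST by auto
  ultimately obtain i :: "'b \<Rightarrow> 'u" where i: "inj_on i T"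
    using card_of_ordLeq[of T "UNIV :: 'u set"] by auto
  define r' where "r' = dir_image (Restr r T) i"
  have FR: "Field (Restr r T) = T"
    using Refl_Field_Restr2[OF _ TF] W wo_rel.REFL wo_rel_def by blast
  have Fr': "Field r' = i ` T" by (simp add: r'_def dir_image_Field FR)
  have W': "Well_order r'"
    unfolding r'_def using Well_order_dir_image[OF Well_order_Restr[OF W]] i FR by metis
  define h where "h = inv_into T i"
  have hi: "h (i x) = x" if "x \<in> T" for x using that i by (simp add: h_def)
  have hT: "h ` Field r' = T" unfolding Fr' using hi by force
  have ord: "(i x, i y) \<in> r' \<longleftrightarrow> (x, y) \<in> r" if "x \<in> T" "y \<in> T" for x y
    using that i by (auto simp: r'_def dir_image_def inj_on_def)
  have "wo_restriction r r' h"
  proof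
    show "noncompact_wo_space r" "Well_order r'" by fact+
    show "h ` Field r' \<subseteq> Field r" using hT TF by simp
    show "(h x, h y) \<in> r \<longleftrightarrow> (x, y) \<in> r'" if "x \<in> Field r'" "y \<in> Field r'" for x y
      using that ord hi unfolding Fr' by auto
    show "closed_cofinal r (h ` Field r')"
      unfolding hT closed_cofinal_def using clT cof ST by blast
  qed
  then show ?thesis by blast
qed

lemma restriction_or_bounded:
  fixes r :: "'b rel"
  assumes N: "noncompact_wo_space r"
  obtains (restr) r' :: "('a + nat) rel" and h where "wo_restriction r r' h"
  | (bounded) "\<forall>(A :: 'a set) \<phi>. \<phi> ` A \<subseteq> Field r \<longrightarrow> (\<exists>c\<in>Field r. \<forall>x\<in>A. (\<phi> x, c) \<in> r)"
      "\<forall>s :: nat \<Rightarrow> 'b. range s \<subseteq> Field r \<longrightarrow> (\<exists>c\<in>Field r. \<forall>n. (s n, c) \<in> r)"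
proof (cases "\<exists>S (e :: 'b \<Rightarrow> 'a + nat). S \<subseteq> Field r \<and> inj_on e S \<and> (\<forall>a\<in>Field r. \<exists>s\<in>S. (a, s) \<in> r)")
  case True
  then obtain S and e :: "'b \<Rightarrow> 'a + nat" where
    S: "S \<subseteq> Field r" "inj_on e S" "\<And>a. a \<in> Field r \<Longrightarrow> \<exists>s\<in>S. (a, s) \<in> r" by blast
  have "infinite (UNIV :: ('a + nat) set)" by simp
  then show ?thesis using restriction_exists[OF N S] restr by blast
next
  case False
  have W: "Well_order r" using N by (simp add: noncompact_wo_space_def)
  have *: "\<exists>c\<in>Field r. \<forall>x\<in>A. (\<phi> x, c) \<in> r"
    if F: "\<phi> ` A \<subseteq> Field r" and j: "inj j" for A :: "'c set" and \<phi> and j :: "'c \<Rightarrow> 'a + nat"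
  proof -
    have "inj_on (j \<circ> inv_into A \<phi>) (\<phi> ` A)"
      using j by (meson comp_inj_on inj_on_inv_into inj_on_subset subset_UNIV order_refl)
    then have "\<not> (\<forall>a\<in>Field r. \<exists>s\<in>\<phi> ` A. (a, s) \<in> r)" using False F by blast
    then obtain c where c: "c \<in> Field r" "\<And>x. x \<in> A \<Longrightarrow> (c, \<phi> x) \<notin> r" by blast
    then have "\<forall>x\<in>A. (\<phi> x, c) \<in> r" using wo_total[OF W c(1)] F by blast
    then show ?thesis using c(1) by blast
  qed
  show ?thesis
  proof (rule bounded; intro allI impI)
    show "\<exists>c\<in>Field r. \<forall>x\<in>A. (\<phi> x, c) \<in> r" if "\<phi> ` A \<subseteq> Field r" for A :: "'a set" and \<phi>
      using *[OF that, of Inl] by simp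
    show "\<exists>c\<in>Field r. \<forall>n. (s n, c) \<in> r" if "range s \<subseteq> Field r" for s :: "nat \<Rightarrow> 'b"
      using *[OF that, of Inr] by simp
  qed
qed

lemma bounded_limit:
  fixes r :: "'b rel" and X :: "'a topology"
  assumes N: "noncompact_wo_space r"
    and bdX: "\<forall>(A :: 'a set) \<phi>. \<phi> ` A \<subseteq> Field r \<longrightarrow> (\<exists>c\<in>Field r. \<forall>x\<in>A. (\<phi> x, c) \<in> r)"
    and bdN: "\<forall>s :: nat \<Rightarrow> 'b. range s \<subseteq> Field r \<longrightarrow> (\<exists>c\<in>Field r. \<forall>n. (s n, c) \<in> r)"
    and f: "continuous_map (wo_topology r) X f"
  shows "\<exists>x\<in>topspace X. \<forall>U. openin X U \<and> x \<in> U \<longrightarrow> (\<exists>a\<in>Field r. f ` aboveS r a \<subseteq> U)"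
proof (rule ccontr)
  assume "\<not> ?thesis"
  then have "\<forall>x\<in>topspace X. \<exists>U. openin X U \<and> x \<in> U \<and> (\<forall>a\<in>Field r. \<exists>b\<in>aboveS r a. f b \<notin> U)"
    by (simp add: image_subset_iff)
  from bchoice[OF this] obtain V where "\<forall>x\<in>topspace X. openin X (V x) \<and> x \<in> V x \<and>
      (\<forall>a\<in>Field r. \<exists>b\<in>aboveS r a. f b \<notin> V x)" ..
  then have V: "\<And>x. x \<in> topspace X \<Longrightarrow> openin X (V x)" "\<And>x. x \<in> topspace X \<Longrightarrow> x \<in> V x"
    "\<And>x a. x \<in> topspace X \<Longrightarrow> a \<in> Field r \<Longrightarrow> \<exists>b\<in>aboveS r a. f b \<notin> V x"
    by simp_all
  have W: "Well_order r" and ne: "Field r \<noteq> {}" using N by (auto simp: noncompact_wo_space_iff)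
  define \<phi> where "\<phi> a x = (SOME b. b \<in> aboveS r a \<and> f b \<notin> V x)" for a x
  have \<phi>: "\<phi> a x \<in> aboveS r a \<and> f (\<phi> a x) \<notin> V x" if "x \<in> topspace X" "a \<in> Field r" for a x
    unfolding \<phi>_def by (rule someI_ex) (use V(3)[OF that] in blast)
  have aF: "b \<in> Field r" if "b \<in> aboveS r a" for a b
    using that by (auto simp: aboveS_def Field_def)
  have "\<forall>a\<in>Field r. \<exists>c. c \<in> Field r \<and> (\<forall>x\<in>topspace X. (\<phi> a x, c) \<in> r)"
  proof
    fix a assume a: "a \<in> Field r"
    have "\<phi> a ` topspace X \<subseteq> Field r" using \<phi>[OF _ a] aF by auto
    then show "\<exists>c. c \<in> Field r \<and> (\<forall>x\<in>topspace X. (\<phi> a x, c) \<in> r)"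
      using bdX[rule_format, of "\<phi> a" "topspace X"] by (simp add: Bex_def)
  qed
  from bchoice[OF this] obtain \<psi> where
    "\<forall>a\<in>Field r. \<psi> a \<in> Field r \<and> (\<forall>x\<in>topspace X. (\<phi> a x, \<psi> a) \<in> r)" ..
  then have \<psi>: "\<And>a. a \<in> Field r \<Longrightarrow> \<psi> a \<in> Field r"
    "\<And>a x. a \<in> Field r \<Longrightarrow> x \<in> topspace X \<Longrightarrow> (\<phi> a x, \<psi> a) \<in> r"
    by simp_all
  obtain a0 where a0: "a0 \<in> Field r" using ne by auto
  define s where "s n = (\<psi> ^^ n) a0" for n
  have sF: "s n \<in> Field r" for n
    unfolding s_def by (induction n) (use a0 \<psi>(1) in auto)
  have sS: "s (Suc n) = \<psi> (s n)" for n by (simp add: s_def)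
  define B where "B = {c \<in> Field r. \<forall>n. (s n, c) \<in> r}"
  have "B \<noteq> {}" "B \<subseteq> Field r" using bdN[rule_format, of s] sF by (auto simp: B_def)
  then obtain c where c: "c \<in> B" "\<And>d. d \<in> B \<Longrightarrow> (c, d) \<in> r"
    using wo_least[OF W] by blast
  have cF: "c \<in> Field r" and cub: "\<And>n. (s n, c) \<in> r" using c(1) by (auto simp: B_def)
  define x where "x = f c"
  have x: "x \<in> topspace X"
    using f cF unfolding x_def by (metis continuous_map_image_subset_topspace image_subset_iff topspace_wo)
  have up: "\<phi> (s n) x \<in> aboveS r (s n)" "(\<phi> (s n) x, c) \<in> r" "f (\<phi> (s n) x) \<notin> V x" for n
    using \<phi>[OF x sF] \<psi>(2)[OF sF x, of n] cub[of "Suc n"] wo_trans[OF W] unfolding sS by blast+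
  have "openin (wo_topology r) {b \<in> topspace (wo_topology r). f b \<in> V x}"
    using openin_continuous_map_preimage[OF f V(1)[OF x]] .
  then have P: "openin (wo_topology r) {b \<in> Field r. f b \<in> V x}" by simp
  have cP: "c \<in> {b \<in> Field r. f b \<in> V x}" using cF V(2)[OF x] by (simp add: x_def)
  have "s 0 \<in> underS r c"
    using up(1,2)[of 0] cub[of 0] wo_antisym[OF W] by (auto simp: underS_def aboveS_def)
  then have "underS r c \<noteq> {}" by blast
  then obtain d where d: "d \<in> underS r c" "aboveS r d \<inter> under r c \<subseteq> {b \<in> Field r. f b \<in> V x}"
    using P cP unfolding openin_wo_iff[OF W] by blast
  have dF: "d \<in> Field r" using d(1) by (auto simp: underS_def Field_def)
  have "d \<notin> B" using c(2) d(1) wo_antisym[OF W] by (auto simp: underS_def)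
  then obtain n where n: "(s n, d) \<notin> r" using dF by (auto simp: B_def)
  then have "(d, s n) \<in> r" using wo_total[OF W dF sF] by blast
  then have "\<phi> (s n) x \<in> aboveS r d"
    using n up(1)[of n] wo_trans[OF W, of d "s n"] by (auto simp: aboveS_def)
  then show False using d(2) up(2,3)[of n] by (auto simp: under_def)
qed

lemma bounded_fibre:
  fixes r :: "'b rel" and f :: "'b \<Rightarrow> 'a"
  assumes N: "noncompact_wo_space r"
    and bdX: "\<forall>(A :: 'a set) \<phi>. \<phi> ` A \<subseteq> Field r \<longrightarrow> (\<exists>c\<in>Field r. \<forall>x\<in>A. (\<phi> x, c) \<in> r)"
  shows "\<exists>x\<in>f ` Field r. \<forall>a\<in>Field r. \<exists>b\<in>aboveS r a. f b = x"
proof (rule ccontr)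
  assume "\<not> ?thesis"
  then have "\<forall>x\<in>f ` Field r. \<exists>a\<in>Field r. \<forall>b\<in>aboveS r a. f b \<noteq> x" by blast
  then obtain \<phi> where \<phi>: "\<And>x. x \<in> f ` Field r \<Longrightarrow> \<phi> x \<in> Field r"
    "\<And>x b. x \<in> f ` Field r \<Longrightarrow> b \<in> aboveS r (\<phi> x) \<Longrightarrow> f b \<noteq> x"
    by metis
  have W: "Well_order r" using N by (simp add: noncompact_wo_space_def)
  obtain c where c: "c \<in> Field r" "\<And>x. x \<in> f ` Field r \<Longrightarrow> (\<phi> x, c) \<in> r"
    using bdX[rule_format, of \<phi> "f ` Field r"] \<phi>(1) by blast
  obtain d where d: "d \<in> aboveS r c" using N c(1) by (auto simp: noncompact_wo_space_iff)
  have dF: "f d \<in> f ` Field r" using d by (auto simp: aboveS_def Field_def)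
  have "d \<in> aboveS r (\<phi> (f d))"
    using c(2)[OF dF] d wo_trans[OF W, of "\<phi> (f d)" c d] wo_antisym[OF W, of c d] by (auto simp: aboveS_def)
  then show False using \<phi>(2)[OF dF] by blast
qed

text \<open>The next three lemmas show that allowing well-orders on an arbitrary type \<open>'b\<close> in the
  three properties does not change them.\<close>

lemma strongly_pseudoradial_any:
  fixes X :: "'a topology"
  assumes sp: "strongly_pseudoradial_on TYPE('b) X"
  shows "strongly_pseudoradial X"
  unfolding strongly_pseudoradial_def strongly_pseudoradial_on_def
proof (intro allI impI)
  fix A assume A: "A \<subseteq> topspace X \<and> \<not> closedin X A"
  then obtain r :: "'b rel" and f where N: "noncompact_wo_space r"
    and f: "continuous_map (wo_compactification r) X f" "f ` (Some ` Field r) \<subseteq> A" "f None \<notin> A"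
    using sp unfolding strongly_pseudoradial_on_def by blast
  from N show "\<exists>(r :: ('a + nat) rel) f. noncompact_wo_space r \<and>
      continuous_map (wo_compactification r) X f \<and> f ` (Some ` Field r) \<subseteq> A \<and> f None \<notin> A"
  proof (cases rule: restriction_or_bounded[where ?'a = 'a])
    case (restr r' h)
    interpret wo_restriction r r' h by fact
    have "continuous_map (wo_compactification r') X (f \<circ> map_option h)"
      using continuous_map_compose[OF continuous_h_compactification f(1)] .
    moreover have "(f \<circ> map_option h) ` (Some ` Field r') \<subseteq> A" "(f \<circ> map_option h) None \<notin> A"
      using f(2,3) h_Field by auto
    ultimately show ?thesis using N' by blast
  next
    case bounded
    obtain x where x: "x \<in> (f \<circ> Some) ` Field r"
      "\<And>a. a \<in> Field r \<Longrightarrow> \<exists>b\<in>aboveS r a. (f \<circ> Some) b = x"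
      using bounded_fibre[OF N bounded(1), of "f \<circ> Some"] by (elim bexE) simp
    have xA: "x \<in> A" using x(1) f(2) by auto
    have fN: "f None \<in> topspace X"
      using continuous_map_image_subset_topspace[OF f(1)] by auto
    have nb: "x \<in> U" if U: "openin X U" "f None \<in> U" for U
    proof -
      have "openin (wo_compactification r) {z \<in> topspace (wo_compactification r). f z \<in> U}"
        using openin_continuous_map_preimage[OF f(1) U(1)] .
      then obtain a where a: "a \<in> Field r" "Some ` aboveS r a \<subseteq> {z. f z \<in> U}"
        using U(2) unfolding openin_wo_compactification[OF N] by auto
      then show ?thesis using x(2)[OF a(1)] by auto
    qed
    define r0 :: "('a + nat) rel" where "r0 = dir_image natLeq Inr"
    have F0: "Field r0 = range Inr" by (simp add: r0_def dir_image_Field Field_natLeq)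
    have "Inr (Suc n) \<in> aboveS r0 (Inr n)" for n
      by (auto simp: r0_def dir_image_def aboveS_def natLeq_def)
    moreover have "Well_order r0"
      unfolding r0_def by (rule Well_order_dir_image[OF natLeq_Well_order]) simp
    ultimately have N0: "noncompact_wo_space r0"
      unfolding noncompact_wo_space_iff F0 by blast
    define g where "g = (\<lambda>z :: ('a + nat) option. case z of None \<Rightarrow> f None | Some _ \<Rightarrow> x)"
    have "continuous_map (wo_compactification r0) X g"
      unfolding continuous_map_def
    proof (intro conjI allI impI)
      show "g \<in> topspace (wo_compactification r0) \<rightarrow> topspace X"
        using fN xA A by (auto simp: g_def)
      fix U assume U: "openin X U"
      let ?P = "{z \<in> topspace (wo_compactification r0). g z \<in> U}"
      consider "f None \<in> U" "x \<in> U" | "f None \<notin> U" "x \<in> U" | "f None \<notin> U" "x \<notin> U"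
        using nb[OF U] by blast
      then show "openin (wo_compactification r0) ?P"
      proof cases
        case 1
        then have "?P = topspace (wo_compactification r0)" by (auto simp: g_def)
        then show ?thesis by (metis openin_topspace)
      next
        case 2
        then have "?P = Some ` topspace (wo_topology r0)" by (auto simp: g_def)
        then show ?thesis
          by (metis openin_topspace openin_Alexandroff_compactification_image_Some)
      next
        case 3
        then have "?P = {}" by (auto simp: g_def split: option.splits)
        then show ?thesis by (metis openin_empty)
      qed
    qed
    moreover have "g ` (Some ` Field r0) \<subseteq> A" "g None \<notin> A"
      using xA f(3) by (auto simp: g_def)
    ultimately show ?thesis using N0 by blast
  qed
qed

lemma decently_strongly_pseudoradially_compact_any:
  fixes X :: "'a topology"
  assumes dc: "decently_strongly_pseudoradially_compact X"
  shows "decently_strongly_pseudoradially_compact_on TYPE('b) X"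
  unfolding decently_strongly_pseudoradially_compact_on_def
proof (intro allI impI)
  fix r :: "'b rel" and f
  assume "noncompact_wo_space r \<and> decent_map r X f"
  then have N: "noncompact_wo_space r" and f: "decent_map r X f" by auto
  from N show "\<exists>\<beta>. closed_cofinal r \<beta> \<and> extendable_at_infinity r X f \<beta>"
  proof (cases rule: restriction_or_bounded[where ?'a = 'a])
    case (restr r' h)
    interpret wo_restriction r r' h by fact
    obtain \<beta> where \<beta>: "closed_cofinal r' \<beta>" "extendable_at_infinity r' X (f \<circ> h) \<beta>"
      using dc N' decent_h[OF f]
      unfolding decently_strongly_pseudoradially_compact_def
        decently_strongly_pseudoradially_compact_on_def by blast
    have "\<beta> \<subseteq> Field r'"
      using \<beta>(1) closedin_subset[of "wo_topology r'" \<beta>] by (simp add: closed_cofinal_def)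
    then show ?thesis using closed_cofinal_h[OF \<beta>(1)] extendable_h[OF \<beta>(2)] by blast
  next
    case bounded
    have W: "Well_order r" using N by (simp add: noncompact_wo_space_def)
    have cf: "continuous_map (wo_topology r) X f" using f by (simp add: decent_map_def)
    have "\<exists>x\<in>topspace X. \<forall>U. openin X U \<and> x \<in> U \<longrightarrow> (\<exists>a\<in>Field r. f ` aboveS r a \<subseteq> U)"
      by (rule bounded_limit) fact+
    then obtain x where x: "x \<in> topspace X"
      "\<And>U. openin X U \<Longrightarrow> x \<in> U \<Longrightarrow> \<exists>a\<in>Field r. f ` aboveS r a \<subseteq> U"
      by (elim bexE) simp
    define F where "F z = (case z of None \<Rightarrow> x | Some b \<Rightarrow> f b)" for z
    have "continuous_map (wo_compactification r) X F"
      unfolding continuous_map_def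
    proof (intro conjI allI impI)
      show "F \<in> topspace (wo_compactification r) \<rightarrow> topspace X"
        using x(1) continuous_map_image_subset_topspace[OF cf] by (auto simp: F_def)
      fix U assume U: "openin X U"
      let ?P = "{z \<in> topspace (wo_compactification r). F z \<in> U}"
      have "{b. Some b \<in> ?P} = {b \<in> topspace (wo_topology r). f b \<in> U}"
        by (auto simp: F_def)
      then have 1: "openin (wo_topology r) {b. Some b \<in> ?P}"
        using openin_continuous_map_preimage[OF cf U] by simp
      have 2: "\<exists>a\<in>Field r. insert None (Some ` aboveS r a) \<subseteq> ?P" if "None \<in> ?P"
      proof -
        have xU: "x \<in> U" using that by (simp add: F_def)
        then obtain a where a: "a \<in> Field r" "f ` aboveS r a \<subseteq> U" using x(2)[OF U] by blast
        then have "insert None (Some ` aboveS r a) \<subseteq> ?P"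
          using xU wo_split[OF W a(1)] by (auto simp: F_def)
        then show ?thesis using a(1) by blast
      qed
      show "openin (wo_compactification r) ?P"
        unfolding openin_wo_compactification[OF N] using 1 2 by auto
    qed
    then have "continuous_map (subtopology (wo_compactification r) (insert None (Some ` Field r))) X F"
      by (rule continuous_map_from_subtopology)
    then have "extendable_at_infinity r X f (Field r)"
      unfolding extendable_at_infinity_def by (intro exI[of _ F]) (simp add: F_def)
    moreover have "closed_cofinal r (Field r)"
      unfolding closed_cofinal_def
      using closedin_topspace[of "wo_topology r"] wo_refl[OF W] by auto
    ultimately show ?thesis by blast
  qed
qed

lemma decently_compact_any:
  fixes X :: "'a topology"
  assumes dc: "decently_compact X"
  shows "decently_compact_on TYPE('b) X"
  unfolding decently_compact_on_def
proof (intro allI impI)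
  fix r :: "'b rel" and f
  assume "noncompact_wo_space r \<and> decent_map r X f"
  then have N: "noncompact_wo_space r" and f: "decent_map r X f" by auto
  have W: "Well_order r" using N by (simp add: noncompact_wo_space_def)
  from N show "(\<Inter>i\<in>Field r. X closure_of {f j | j. j \<in> Field r \<and> (i, j) \<in> r}) \<noteq> {}"
  proof (cases rule: restriction_or_bounded[where ?'a = 'a])
    case (restr r' h)
    interpret R: wo_restriction r r' h by fact
    obtain x where x: "\<And>i. i \<in> Field r' \<Longrightarrow>
        x \<in> X closure_of {(f \<circ> h) j | j. j \<in> Field r' \<and> (i, j) \<in> r'}"
      using dc R.N' R.decent_h[OF f] unfolding decently_compact_def decently_compact_on_def by blast
    have "x \<in> X closure_of {f j | j. j \<in> Field r \<and> (i, j) \<in> r}" if i: "i \<in> Field r" for i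
    proof -
      obtain i' where i': "i' \<in> Field r'" "(i, h i') \<in> r" using R.cofinal[OF i] by blast
      have "{(f \<circ> h) j | j. j \<in> Field r' \<and> (i', j) \<in> r'} \<subseteq> {f j | j. j \<in> Field r \<and> (i, j) \<in> r}"
      proof
        fix y assume "y \<in> {(f \<circ> h) j | j. j \<in> Field r' \<and> (i', j) \<in> r'}"
        then obtain j where j: "y = f (h j)" "j \<in> Field r'" "(i', j) \<in> r'" by auto
        then have "(i, h j) \<in> r" using R.h_ord[OF i'(1) j(2)] i'(2) wo_trans[OF W] by blast
        then show "y \<in> {f j | j. j \<in> Field r \<and> (i, j) \<in> r}" using j R.h_Field by blast
      qed
      then show ?thesis using x[OF i'(1)] closure_of_mono by blast
    qed
    then show ?thesis by blast
  next
    case bounded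
    have cf: "continuous_map (wo_topology r) X f" using f by (simp add: decent_map_def)
    have "\<exists>x\<in>topspace X. \<forall>U. openin X U \<and> x \<in> U \<longrightarrow> (\<exists>a\<in>Field r. f ` aboveS r a \<subseteq> U)"
      by (rule bounded_limit) fact+
    then obtain x where x: "x \<in> topspace X"
      "\<And>U. openin X U \<Longrightarrow> x \<in> U \<Longrightarrow> \<exists>a\<in>Field r. f ` aboveS r a \<subseteq> U"
      by (elim bexE) simp
    have "x \<in> X closure_of {f j | j. j \<in> Field r \<and> (i, j) \<in> r}" if i: "i \<in> Field r" for i
      unfolding in_closure_of
    proof (intro conjI allI impI)
      show "x \<in> topspace X" by fact
      fix U assume "x \<in> U \<and> openin X U"
      then obtain a where a: "a \<in> Field r" "f ` aboveS r a \<subseteq> U" using x(2) by blast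
      obtain m where m: "m \<in> Field r" "(a, m) \<in> r" "(i, m) \<in> r"
        using wo_total[OF W a(1) i] wo_refl[OF W a(1)] wo_refl[OF W i] a(1) i by blast
      obtain b where b: "b \<in> aboveS r m" using N m(1) by (auto simp: noncompact_wo_space_iff)
      have "b \<in> aboveS r a" "(i, b) \<in> r" "b \<in> Field r"
        using b m wo_trans[OF W, of _ m b] wo_antisym[OF W, of m b]
        by (auto simp: aboveS_def Field_def)
      then show "\<exists>y. y \<in> {f j | j. j \<in> Field r \<and> (i, j) \<in> r} \<and> y \<in> U" using a(2) by blast
    qed
    then show ?thesis by blast
  qed
qed

end

theory Submission
  imports Defs
begin

text \<open>
  Let \<open>g\<close> witness that \<open>f : \<alpha> \<rightarrow> X\<close> is decent. Since \<open>g j\<close> lies in the closure of \<open>{f j}\<close>,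
  every limit of \<open>g\<close> along a cofinal set is also a limit of \<open>f\<close>, so it suffices to extend \<open>g\<close>.
  If all tails \<open>g [i, \<infinity>)\<close> are closed, decent compactness gives a point in all of them; its fibre is
  closed and cofinal, and \<open>g\<close> is constant on it. Otherwise some tail \<open>A = g [i, \<infinity>)\<close> is not closed,
  and there is a map \<open>e : \<delta> \<union> {\<infinity>} \<rightarrow> X\<close> with \<open>e \<delta> \<subseteq> A\<close> and \<open>e \<infinity> \<notin> A\<close>. As the sets \<open>g [i, a]\<close> are closed,
  \<open>e\<close> eventually leaves each of them. Let \<open>\<beta>\<close> consist of those \<open>a \<ge> i\<close> for which \<open>g a = e d\<close> for some
  \<open>d\<close> with \<open>e [d, \<infinity>)\<close> disjoint from \<open>g [i, a)\<close>. Then \<open>\<beta>\<close> is closed and cofinal, and \<open>g\<close> tends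
  to \<open>e \<infinity>\<close> along \<open>\<beta>\<close>.
\<close>

section \<open>Extensions at infinity described by limits along tails\<close>

lemma openin_subtopology_wo_compactification_None:
  assumes N: "noncompact_wo_space r"
    and "openin (subtopology (wo_compactification r) (insert None (Some ` \<beta>))) P" "None \<in> P"
  obtains a where "a \<in> Field r" "Some ` (\<beta> \<inter> aboveS r a) \<subseteq> P"
proof -
  obtain T where T: "openin (wo_compactification r) T" "P = T \<inter> insert None (Some ` \<beta>)"
    using assms(2) unfolding openin_subtopology by blast
  then obtain a where "a \<in> Field r" "insert None (Some ` aboveS r a) \<subseteq> T"
    using assms(3) unfolding openin_wo_compactification[OF N] by blast
  then show thesis using T(2) that by blast
qed

text \<open>The extension sends \<open>None\<close> to \<open>x\<close>. If \<open>x\<close> is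
  outside \<open>U\<close>, the preimage of \<open>U\<close> is the trace of an open subset of the
  original space; if \<open>x\<close> is in \<open>U\<close>, a ray supplied by \<open>lim\<close>
  makes the preimage a neighbourhood of \<open>None\<close>.\<close>

lemma extendable_at_infinityI:
  assumes N: "noncompact_wo_space r" and f: "continuous_map (wo_topology r) X f"
    and x: "x \<in> topspace X"
    and lim: "\<And>U. openin X U \<Longrightarrow> x \<in> U \<Longrightarrow> \<exists>a\<in>Field r. f ` (\<beta> \<inter> aboveS r a) \<subseteq> U"
  shows "extendable_at_infinity r X f \<beta>"
proof -
  have W: "Well_order r" using N by (simp add: noncompact_wo_space_def)
  let ?S = "insert None (Some ` \<beta>)"
  define F where "F z = (case z of None \<Rightarrow> x | Some b \<Rightarrow> f b)" for z
  have F: "F None = x" "\<And>b. F (Some b) = f b" by (simp_all add: F_def)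
  have "continuous_map (subtopology (wo_compactification r) ?S) X F"
    unfolding continuous_map_def
  proof (intro conjI allI impI)
    show "F \<in> topspace (subtopology (wo_compactification r) ?S) \<rightarrow> topspace X"
      using x continuous_map_image_subset_topspace[OF f] by (auto simp: F)
    fix U assume U: "openin X U"
    let ?P = "{z \<in> topspace (subtopology (wo_compactification r) ?S). F z \<in> U}"
    let ?V = "{b \<in> topspace (wo_topology r). f b \<in> U}"
    have V: "openin (wo_topology r) ?V" using openin_continuous_map_preimage[OF f U] .
    show "openin (subtopology (wo_compactification r) ?S) ?P"
    proof (cases "x \<in> U")
      case False
      then have "?P = Some ` ?V \<inter> ?S" by (auto simp: F)
      moreover have "openin (wo_compactification r) (Some ` ?V)" using V by simp
      ultimately show ?thesis unfolding openin_subtopology by blast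
    next
      case True
      then obtain a where a: "a \<in> Field r" "f ` (\<beta> \<inter> aboveS r a) \<subseteq> U" using lim[OF U] by blast
      \<comment> \<open>The ray may contain points that \<open>f\<close> sends outside
        \<open>U\<close>, but they lie outside \<open>\<beta>\<close> and disappear in the trace on
        \<open>?S\<close>.\<close>
      define T where "T = insert None (Some ` (?V \<union> aboveS r a))"
      have aF: "aboveS r a \<subseteq> Field r" using wo_split[OF W a(1)] by blast
      have "{z. Some z \<in> T} = ?V \<union> aboveS r a" by (auto simp: T_def)
      then have "openin (wo_topology r) {z. Some z \<in> T}"
        using V openin_wo_aboveS[OF a(1)] by auto
      then have "openin (wo_compactification r) T"
        unfolding openin_wo_compactification[OF N] using a(1) aF by (auto simp: T_def)
      moreover have "?P = T \<inter> ?S"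
        using a(2) aF True by (auto simp: F T_def)
      ultimately show ?thesis unfolding openin_subtopology by blast
    qed
  qed
  then show ?thesis unfolding extendable_at_infinity_def using F(2) by blast
qed

section \<open>From extensions to cluster points\<close>

lemma wo_upper_bound_strict:
  assumes N: "noncompact_wo_space r" and "a \<in> Field r" "b \<in> Field r"
  obtains c where "c \<in> aboveS r a" "c \<in> aboveS r b"
proof -
  have W: "Well_order r" using N by (simp add: noncompact_wo_space_def)
  obtain m where m: "m \<in> Field r" "(a, m) \<in> r" "(b, m) \<in> r"
    using wo_total[OF W assms(2,3)] wo_refl[OF W] assms(2,3) by blast
  obtain c where c: "c \<in> aboveS r m" using N m(1) by (auto simp: noncompact_wo_space_iff)
  then have "c \<in> aboveS r a" "c \<in> aboveS r b"
    using m wo_trans[OF W, of _ m c] wo_antisym[OF W, of m c] by (auto simp: aboveS_def)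
  then show thesis by (rule that)
qed

text \<open>The value of the extension at infinity is the required point: each of its neighbourhoods
  contains \<open>f b\<close> for all late \<open>b\<close> in \<open>\<beta>\<close>, and
  cofinality provides such a \<open>b\<close> past any given \<open>i\<close>.\<close>

lemma extendable_at_infinity_cluster_point:
  assumes N: "noncompact_wo_space r" and \<beta>: "closed_cofinal r \<beta>"
    and ext: "extendable_at_infinity r X f \<beta>"
  shows "(\<Inter>i\<in>Field r. X closure_of {f j | j. j \<in> Field r \<and> (i, j) \<in> r}) \<noteq> {}"
proof -
  have W: "Well_order r" using N by (simp add: noncompact_wo_space_def)
  let ?Y = "subtopology (wo_compactification r) (insert None (Some ` \<beta>))"
  obtain F where F: "continuous_map ?Y X F" "\<And>b. b \<in> \<beta> \<Longrightarrow> F (Some b) = f b"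
    using ext by (auto simp: extendable_at_infinity_def)
  have cof: "\<exists>b\<in>\<beta>. (a, b) \<in> r" if "a \<in> Field r" for a
    using \<beta> that by (auto simp: closed_cofinal_def)
  have "F None \<in> X closure_of {f j | j. j \<in> Field r \<and> (i, j) \<in> r}" if i: "i \<in> Field r" for i
    unfolding in_closure_of
  proof (intro conjI allI impI)
    show "F None \<in> topspace X"
      using continuous_map_image_subset_topspace[OF F(1)] by auto
    fix U assume U: "F None \<in> U \<and> openin X U"
    have "openin ?Y {z \<in> topspace ?Y. F z \<in> U}"
      using openin_continuous_map_preimage[OF F(1)] U by blast
    moreover have "None \<in> {z \<in> topspace ?Y. F z \<in> U}" using U by simp
    ultimately obtain a where a: "a \<in> Field r"
        "Some ` (\<beta> \<inter> aboveS r a) \<subseteq> {z \<in> topspace ?Y. F z \<in> U}"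
      by (rule openin_subtopology_wo_compactification_None[OF N])
    obtain c where c: "c \<in> aboveS r a" "c \<in> aboveS r i"
      using wo_upper_bound_strict[OF N a(1) i] .
    obtain b where b: "b \<in> \<beta>" "(c, b) \<in> r"
      using cof c(1) by (auto simp: aboveS_def Field_def)
    have "b \<in> aboveS r a" "(i, b) \<in> r" "b \<in> Field r"
      using b c wo_trans[OF W, of _ c b] wo_antisym[OF W, of a c]
      by (auto simp: aboveS_def Field_def)
    then show "\<exists>y. y \<in> {f j | j. j \<in> Field r \<and> (i, j) \<in> r} \<and> y \<in> U"
      using a(2) b(1) F(2) by force
  qed
  then show ?thesis by blast
qed

section \<open>The case of a nonclosed tail\<close>

lemma closed_cofinal_limit_along_nonclosed_tail:
  fixes r :: "'b rel" and s :: "'c rel"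
  assumes N: "noncompact_wo_space r" and g: "continuous_map (wo_topology r) X g"
    and gcl: "\<And>C. compactin (wo_topology r) C \<Longrightarrow> closedin X (g ` C)"
    and i: "i \<in> Field r" and M: "noncompact_wo_space s"
    and e: "continuous_map (wo_compactification s) X e"
    and eA: "e ` (Some ` Field s) \<subseteq> g ` above r i" and eN: "e None \<notin> g ` above r i"
  obtains \<beta> where "closed_cofinal r \<beta>"
    "\<And>U. openin X U \<Longrightarrow> e None \<in> U \<Longrightarrow> \<exists>a\<in>Field r. g ` (\<beta> \<inter> aboveS r a) \<subseteq> U"
proof -
  have W: "Well_order r" using N by (simp add: noncompact_wo_space_def)
  have Ws: "Well_order s" using M by (simp add: noncompact_wo_space_def)
  have eT: "e z \<in> topspace X" if "z \<in> insert None (Some ` Field s)" for z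
    using continuous_map_image_subset_topspace[OF e] that by auto
  \<comment> \<open>Convergence of \<open>e\<close> is put in terms of a closed ray
    \<open>[d, \<infinity>)\<close>, the form used in \<open>fits\<close>; any \<open>d\<close> in
    the open ray given by the topology works.\<close>
  have tail: "\<exists>d\<in>Field s. \<forall>d'. (d, d') \<in> s \<longrightarrow> e (Some d') \<in> U"
    if U: "openin X U" "e None \<in> U" for U
  proof -
    have "openin (wo_compactification s) {z \<in> topspace (wo_compactification s). e z \<in> U}"
      using openin_continuous_map_preimage[OF e U(1)] .
    then obtain a where a: "a \<in> Field s" "Some ` aboveS s a \<subseteq> {z. e z \<in> U}"
      using U(2) unfolding openin_wo_compactification[OF M] by auto
    obtain d where d: "d \<in> aboveS s a" using M a(1) by (auto simp: noncompact_wo_space_iff)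
    have "d' \<in> aboveS s a" if "(d, d') \<in> s" for d'
      using that d wo_trans[OF Ws, of a d d'] wo_antisym[OF Ws, of a d] by (auto simp: aboveS_def)
    then show ?thesis using a d by (auto simp: aboveS_def Field_def)
  qed
  have eA': "\<exists>a. (i, a) \<in> r \<and> g a = e (Some d)" if d: "d \<in> Field s" for d
  proof -
    have "e (Some d) \<in> g ` above r i" using eA d by blast
    then show ?thesis by (auto simp: above_def)
  qed
  have leave: "\<exists>d\<in>Field s. \<forall>d' a'. (d, d') \<in> s \<and> (i, a') \<in> r \<and> (a', a) \<in> r \<longrightarrow> e (Some d') \<noteq> g a'"
    if a: "a \<in> Field r" for a
  proof -
    \<comment> \<open>This set is the interval \<open>[i, a]\<close>. It is compact, so its image is
      closed, and the complement of the image is a neighbourhood of \<open>e None\<close>.\<close>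
    have "closedin (wo_topology r) (under r a - underS r i)"
      using closedin_diff[OF closedin_wo_under[OF W a] openin_wo_underS[OF i]] .
    then have "compactin (wo_topology r) (under r a - underS r i)"
      using closed_compactin[OF compactin_wo_under[OF W]] by blast
    then have cl: "closedin X (g ` (under r a - underS r i))" by (rule gcl)
    have "under r a - underS r i \<subseteq> above r i"
      using wo_total[OF W i] wo_refl[OF W i] by (auto simp: under_def underS_def above_def dest: wo_field)
    then have "e None \<in> topspace X - g ` (under r a - underS r i)" using eN eT by blast
    then obtain d where d: "d \<in> Field s"
        "\<forall>d'. (d, d') \<in> s \<longrightarrow> e (Some d') \<in> topspace X - g ` (under r a - underS r i)"
      using tail[of "topspace X - g ` (under r a - underS r i)"] cl by blast
    have "a' \<in> under r a - underS r i" if "(i, a') \<in> r" "(a', a) \<in> r" for a'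
      using that wo_antisym[OF W] by (auto simp: under_def underS_def)
    then show ?thesis using d by blast
  qed
  define fits where "fits a d \<longleftrightarrow> d \<in> Field s \<and> g a = e (Some d) \<and>
      (\<forall>d' a'. (d, d') \<in> s \<and> (i, a') \<in> r \<and> a' \<in> underS r a \<longrightarrow> e (Some d') \<noteq> g a')" for a d
  define \<beta> where "\<beta> = {a. (i, a) \<in> r \<and> (\<exists>d. fits a d)}"
  have \<beta>F: "\<beta> \<subseteq> Field r" by (auto simp: \<beta>_def Field_def)
  \<comment> \<open>The monotonicity of the matching: a value of \<open>g\<close> on
    \<open>[i, a)\<close> can be taken by \<open>e\<close> only before \<open>d\<close>. Both the
    closedness of \<open>\<beta>\<close> and the limit rest on it.\<close>
  have fits_less: "d' \<in> underS s d"
    if "fits a d" "(i, a') \<in> r" "a' \<in> underS r a" "g a' = e (Some d')" "d' \<in> Field s" for a d a' d'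
  proof -
    have "(d, d') \<notin> s" and dF: "d \<in> Field s" using that unfolding fits_def by metis+
    then show ?thesis
      using wo_total[OF Ws dF that(5)] wo_refl[OF Ws dF] by (auto simp: underS_def)
  qed
  have cof: "\<exists>b\<in>\<beta>. (a0, b) \<in> r" if a0: "a0 \<in> Field r" for a0
  proof -
    obtain d0 where d0: "d0 \<in> Field s"
      "\<And>d' a'. (d0, d') \<in> s \<Longrightarrow> (i, a') \<in> r \<Longrightarrow> (a', a0) \<in> r \<Longrightarrow> e (Some d') \<noteq> g a'"
      using leave[OF a0] by blast
    \<comment> \<open>The least position whose value \<open>e\<close> takes at or after
      \<open>d0\<close> fits the index found there: an earlier position hit later by
      \<open>e\<close> would also be in \<open>B\<close>.\<close>
    define B where "B = {a. (i, a) \<in> r \<and> (\<exists>d. (d0, d) \<in> s \<and> g a = e (Some d))}"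
    have "B \<subseteq> Field r" "B \<noteq> {}"
      using eA'[OF d0(1)] wo_refl[OF Ws d0(1)] by (auto simp: B_def Field_def)
    then obtain a where a: "a \<in> B" "\<And>b. b \<in> B \<Longrightarrow> (a, b) \<in> r"
      using wo_least[OF W] by blast
    then obtain d where d: "(i, a) \<in> r" "(d0, d) \<in> s" "g a = e (Some d)" by (auto simp: B_def)
    have "fits a d"
      unfolding fits_def
    proof (intro conjI allI impI notI)
      show "d \<in> Field s" "g a = e (Some d)" using d by (auto dest: wo_field)
      fix d' a' assume h: "(d, d') \<in> s \<and> (i, a') \<in> r \<and> a' \<in> underS r a" "e (Some d') = g a'"
      then have "a' \<in> B" using wo_trans[OF Ws d(2), of d'] by (auto simp: B_def)
      then show False using a(2) h wo_antisym[OF W] by (auto simp: underS_def)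
    qed
    then have "a \<in> \<beta>" using d by (auto simp: \<beta>_def)
    \<comment> \<open>From \<open>d0\<close> on, \<open>e\<close> avoids \<open>g\<close> on
      \<open>[i, a0]\<close>, so the position found lies past \<open>a0\<close>.\<close>
    moreover have "(a, a0) \<notin> r" using d0(2)[OF d(2,1)] d(3) by auto
    then have "(a0, a) \<in> r" using wo_total[OF W a0, of a] \<open>a \<in> \<beta>\<close> \<beta>F by blast
    ultimately show ?thesis by blast
  qed
  have "closedin (wo_topology r) \<beta>"
  proof -
    have "a \<in> \<beta>" if acl: "a \<in> wo_topology r closure_of \<beta>" for a
    proof (rule ccontr)
      assume na: "a \<notin> \<beta>"
      have aF: "a \<in> Field r" using acl by (simp add: in_closure_of)
      have meets: "\<exists>b\<in>\<beta>. b \<in> T" if "openin (wo_topology r) T" "a \<in> T" for T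
        using acl that by (auto simp: in_closure_of)
      \<comment> \<open>Since \<open>a\<close> itself is not in \<open>\<beta>\<close>, points of
        \<open>\<beta>\<close> accumulate at \<open>a\<close> strictly from below.\<close>
      have near: "\<exists>b\<in>\<beta>. b \<in> aboveS r a' \<and> b \<in> underS r a" if a': "a' \<in> underS r a" for a'
      proof -
        have a'F: "a' \<in> Field r" using a' by (auto simp: underS_def Field_def)
        have "openin (wo_topology r) (aboveS r a' \<inter> under r a)"
          using openin_wo_aboveS[OF a'F] openin_wo_under[OF W aF] by blast
        moreover have "a \<in> aboveS r a' \<inter> under r a"
          using a' wo_refl[OF W aF] by (auto simp: aboveS_def under_def underS_def)
        ultimately obtain b where "b \<in> \<beta>" "b \<in> aboveS r a' \<inter> under r a" using meets by blast
        then show ?thesis using na by (auto simp: under_def underS_def)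
      qed
      have ia: "i \<in> underS r a"
      proof -
        obtain b where b: "b \<in> \<beta>" "b \<in> under r a"
          using meets[OF openin_wo_under[OF W aF]] wo_refl[OF W aF] by (auto simp: under_def)
        then have "(i, b) \<in> r" "(b, a) \<in> r" "b \<noteq> a" using na by (auto simp: \<beta>_def under_def)
        then show ?thesis using wo_trans[OF W, of i b a] wo_antisym[OF W, of b a] by (auto simp: underS_def)
      qed
      \<comment> \<open>The candidate index for \<open>a\<close> is the least \<open>D\<close> from
        which on \<open>e\<close> avoids \<open>g\<close> on \<open>[i, a)\<close>. Only
        \<open>g a = e (Some D)\<close> is then missing for \<open>fits a D\<close>.\<close>
      define Q where "Q = {d \<in> Field s. \<forall>d' a'. (d, d') \<in> s \<and> (i, a') \<in> r \<and> a' \<in> underS r a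
          \<longrightarrow> e (Some d') \<noteq> g a'}"
      have "Q \<noteq> {}" using leave[OF aF] by (auto simp: Q_def underS_def)
      moreover have "Q \<subseteq> Field s" by (auto simp: Q_def)
      ultimately obtain D where D: "D \<in> Q" "\<And>d. d \<in> Q \<Longrightarrow> (D, d) \<in> s"
        using wo_least[OF Ws] by blast
      have DF: "D \<in> Field s" using D(1) by (auto simp: Q_def)
      have below: "d \<in> underS s D" if "fits b d" "b \<in> \<beta>" "b \<in> underS r a" for b d
      proof -
        have dF: "d \<in> Field s" and "g b = e (Some d)" "(i, b) \<in> r"
          using that unfolding fits_def \<beta>_def by blast+
        then have "(D, d) \<notin> s" using that(3) D(1) unfolding Q_def by force
        then show ?thesis
          using wo_total[OF Ws DF dF] wo_refl[OF Ws DF] by (auto simp: underS_def)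
      qed
      have "g a = e (Some D)"
      proof (rule ccontr)
        assume ne: "g a \<noteq> e (Some D)"
        obtain c where c: "(i, c) \<in> r" "g c = e (Some D)" using eA'[OF DF] by blast
        \<comment> \<open>Every value of \<open>e\<close> on \<open>Field s\<close> is a value of
          \<open>g\<close>, hence a closed point. So \<open>g\<close> avoids
          \<open>e (Some D)\<close> on a whole interval \<open>(a', a]\<close>.\<close>
        have "closedin X (g ` {c})"
          by (rule gcl) (use c wo_field[of i c r] in auto)
        then have "openin X (topspace X - {e (Some D)})" using c by auto
        from openin_continuous_map_preimage[OF g this]
        have "openin (wo_topology r) {b \<in> Field r. g b \<in> topspace X - {e (Some D)}}" by simp
        moreover have "a \<in> {b \<in> Field r. g b \<in> topspace X - {e (Some D)}}"
          using ne aF continuous_map_image_subset_topspace[OF g] by auto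
        ultimately obtain a' where a': "a' \<in> underS r a"
            "aboveS r a' \<inter> under r a \<subseteq> {b \<in> Field r. g b \<in> topspace X - {e (Some D)}}"
          using ia unfolding openin_wo_iff[OF W] by blast
        let ?I = "aboveS r a' \<inter> under r a"
        have a'F: "a' \<in> Field r" using a' by (auto simp: underS_def Field_def)
        have "?I = under r a - under r a'"
          using wo_split[OF W a'F] under_subset_Field[of r a] by auto
        then have "closedin (wo_topology r) ?I"
          using closedin_diff[OF closedin_wo_under[OF W aF] openin_wo_under[OF W a'F]] by simp
        then have "compactin (wo_topology r) ?I"
          using closed_compactin[OF compactin_wo_under[OF W]] by blast
        \<comment> \<open>Now the roles are exchanged: the image of the compact interval
          \<open>(a', a]\<close> is closed and misses \<open>e (Some D)\<close>, so \<open>e\<close>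
          avoids it on some \<open>(d1, D]\<close>.\<close>
        then have "openin X (topspace X - g ` ?I)" using gcl by blast
        from openin_continuous_map_preimage[OF continuous_map_compose[OF continuous_map_Some e] this]
        have P: "openin (wo_topology s) {d \<in> Field s. e (Some d) \<in> topspace X - g ` ?I}"
          by (simp add: comp_def)
        have DP: "D \<in> {d \<in> Field s. e (Some d) \<in> topspace X - g ` ?I}"
        proof -
          have "e (Some D) \<notin> g ` ?I" using a'(2) by force
          then show ?thesis using DF eT[of "Some D"] by simp
        qed
        \<comment> \<open>A left interval \<open>(d1, D]\<close> exists only if \<open>D\<close> is
          not the least index; a point of \<open>\<beta>\<close> below \<open>a\<close> has its
          index below \<open>D\<close>.\<close>
        obtain b0 where b0: "b0 \<in> \<beta>" "b0 \<in> underS r a" using near[OF a'(1)] by blast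
        then obtain db0 where "fits b0 db0" by (auto simp: \<beta>_def)
        then have "underS s D \<noteq> {}" using below b0 by blast
        then obtain d1 where d1: "d1 \<in> underS s D"
            "aboveS s d1 \<inter> under s D \<subseteq> {d \<in> Field s. e (Some d) \<in> topspace X - g ` ?I}"
          using P DP unfolding openin_wo_iff[OF Ws] by blast
        have d1F: "d1 \<in> Field s" using d1 by (auto simp: underS_def Field_def)
        \<comment> \<open>By minimality of \<open>D\<close>, \<open>e\<close> meets \<open>g\<close>
          on \<open>[i, a)\<close> again at some \<open>d2 \<ge> d1\<close>.\<close>
        have "d1 \<notin> Q" using D(2) d1(1) wo_antisym[OF Ws] by (auto simp: underS_def)
        then obtain d2 a2 where d2: "(d1, d2) \<in> s" "(i, a2) \<in> r" "a2 \<in> underS r a" "e (Some d2) = g a2"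
          using d1F by (auto simp: Q_def)
        obtain b1 where b1: "b1 \<in> \<beta>" "b1 \<in> aboveS r a'" "b1 \<in> underS r a" using near[OF a'(1)] by blast
        obtain m where m: "m \<in> underS r a" "(b1, m) \<in> r" "(a2, m) \<in> r"
        proof -
          have "b1 \<in> Field r" "a2 \<in> Field r" using \<beta>F b1(1) d2(2) by (auto dest: wo_field)
          then consider "(b1, a2) \<in> r" "(a2, a2) \<in> r" | "(a2, b1) \<in> r" "(b1, b1) \<in> r"
            using wo_total[OF W] wo_refl[OF W] by blast
          then show thesis using that[of b1] that[of a2] b1(3) d2(3) by cases auto
        qed
        \<comment> \<open>This \<open>b\<close> lies in \<open>\<beta>\<close> with
          \<open>a'\<close> and \<open>a2\<close> below it and \<open>a\<close> above it. Its index
          \<open>d\<close> exceeds \<open>d2\<close>, hence lies in \<open>(d1, D]\<close>, where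
          \<open>e\<close> avoids \<open>g\<close> on \<open>(a', a]\<close>; but
          \<open>e (Some d) = g b\<close>.\<close>
        obtain b where b: "b \<in> \<beta>" "b \<in> aboveS r m" "b \<in> underS r a" using near[OF m(1)] by blast
        have ba2: "a2 \<in> underS r b"
          using b(2) m(3) wo_trans[OF W, of a2 m b] wo_antisym[OF W, of m b]
          by (auto simp: underS_def aboveS_def)
        have "(a', m) \<in> r" using b1(2) m(2) wo_trans[OF W, of a' b1 m] by (auto simp: aboveS_def)
        then have ba': "b \<in> aboveS r a'"
          using b(2) wo_trans[OF W, of a' m b] wo_antisym[OF W, of m b] by (auto simp: aboveS_def)
        obtain d where d: "fits b d" using b by (auto simp: \<beta>_def)
        have "d2 \<in> underS s d"
          using fits_less[OF d d2(2) ba2] d2(1,4) wo_field[of d1 d2 s] by auto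
        then have "d \<in> aboveS s d1"
          using d2(1) wo_trans[OF Ws, of d1 d2 d] wo_antisym[OF Ws, of d1 d2] by (auto simp: aboveS_def underS_def)
        moreover have "d \<in> under s D" using below[OF d b(1,3)] by (auto simp: under_def underS_def)
        ultimately have "e (Some d) \<notin> g ` ?I" using d1(2) by blast
        moreover have "b \<in> ?I" using ba' b(3) by (auto simp: under_def underS_def)
        moreover have "g b = e (Some d)" using d by (simp add: fits_def)
        ultimately show False by (metis imageI)
      qed
      then have "fits a D" using D(1) by (auto simp: fits_def Q_def)
      then show False using na ia by (auto simp: \<beta>_def underS_def)
    qed
    then have "wo_topology r closure_of \<beta> \<subseteq> \<beta>" by blast
    then show ?thesis using \<beta>F closure_of_subset_eq[of \<beta> "wo_topology r"] by simp
  qed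
  then have "closed_cofinal r \<beta>" using cof by (simp add: closed_cofinal_def)
  moreover have "\<exists>a\<in>Field r. g ` (\<beta> \<inter> aboveS r a) \<subseteq> U" if U: "openin X U" "e None \<in> U" for U
  proof -
    obtain d0 where d0: "d0 \<in> Field s" "\<And>d'. (d0, d') \<in> s \<Longrightarrow> e (Some d') \<in> U"
      using tail[OF U] by blast
    \<comment> \<open>Beyond a position \<open>a0\<close> with value \<open>e (Some d0)\<close>,
      every point of \<open>\<beta>\<close> has an index greater than \<open>d0\<close>.\<close>
    obtain a0 where a0: "(i, a0) \<in> r" "g a0 = e (Some d0)" using eA'[OF d0(1)] by blast
    have "g a \<in> U" if a: "a \<in> \<beta>" "a \<in> aboveS r a0" for a
    proof -
      obtain d where d: "fits a d" using a by (auto simp: \<beta>_def)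
      have "a0 \<in> underS r a" using a(2) by (auto simp: aboveS_def underS_def)
      then have "d0 \<in> underS s d" using fits_less[OF d a0(1) _ a0(2) d0(1)] by blast
      then show ?thesis using d d0(2) by (auto simp: fits_def underS_def)
    qed
    then show ?thesis using wo_field[OF a0(1)] by blast
  qed
  ultimately show thesis by (rule that)
qed

section \<open>Closed and nonclosed tails combined\<close>

text \<open>The index type \<open>'c\<close> is independent of \<open>'b\<close> because the
  well-order from pseudoradiality is compared with \<open>r\<close> only through values in
  \<open>X\<close>.\<close>

lemma decent_map_extendable:
  fixes X :: "'a topology" and r :: "'b rel"
  assumes sp: "strongly_pseudoradial_on TYPE('c) X" and dc: "decently_compact_on TYPE('b) X"
    and N: "noncompact_wo_space r" and f: "decent_map r X f"
  shows "\<exists>\<beta>. closed_cofinal r \<beta> \<and> extendable_at_infinity r X f \<beta>"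
proof -
  have W: "Well_order r" using N by (simp add: noncompact_wo_space_def)
  have ne: "Field r \<noteq> {}" using N by (simp add: noncompact_wo_space_iff)
  obtain g where cf: "continuous_map (wo_topology r) X f"
    and g: "continuous_map (wo_topology r) X g" "\<And>i. i \<in> Field r \<Longrightarrow> g i \<in> X closure_of {f i}"
      "\<And>C. compactin (wo_topology r) C \<Longrightarrow> closedin X (g ` C)"
    using f unfolding decent_map_def by blast
  have gT: "g j \<in> topspace X" if "j \<in> Field r" for j
    using continuous_map_image_subset_topspace[OF g(1)] that by auto
  have aF: "above r i \<subseteq> Field r" for i by (auto simp: above_def Field_def)
  have "\<exists>\<beta> x. closed_cofinal r \<beta> \<and> x \<in> topspace X \<and>
      (\<forall>U. openin X U \<longrightarrow> x \<in> U \<longrightarrow> (\<exists>a\<in>Field r. g ` (\<beta> \<inter> aboveS r a) \<subseteq> U))"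
  proof (cases "\<forall>i\<in>Field r. closedin X (g ` above r i)")
    case True
    \<comment> \<open>The map \<open>g\<close> is its own witness of decency, so decent compactness
      applies to it.\<close>
    have "g j \<in> X closure_of {g j}" if "j \<in> Field r" for j
      using gT[OF that] by (auto simp: in_closure_of)
    then have "decent_map r X g" unfolding decent_map_def using g by blast
    then obtain x where x: "\<And>i. i \<in> Field r \<Longrightarrow>
        x \<in> X closure_of {g j | j. j \<in> Field r \<and> (i, j) \<in> r}"
      using dc N unfolding decently_compact_on_def by blast
    have xi: "x \<in> g ` above r i" if i: "i \<in> Field r" for i
    proof -
      have "{g j | j. j \<in> Field r \<and> (i, j) \<in> r} = g ` above r i"
        by (auto simp: above_def Field_def)
      then show ?thesis using x[OF i] True i by (simp add: closure_of_closedin)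
    qed
    define \<beta> where "\<beta> = {j \<in> Field r. g j = x}"
    obtain j where j: "j \<in> Field r" "g j = x" using xi ne aF by blast
    \<comment> \<open>The cluster point is a value of \<open>g\<close>, hence a closed point, which
      makes its fibre closed.\<close>
    have "closedin X (g ` {j})" by (rule g(3)) (use j in auto)
    then have "closedin X {x}" using j by simp
    from closedin_continuous_map_preimage[OF g(1) this]
    have "closedin (wo_topology r) \<beta>" by (simp add: \<beta>_def)
    moreover have "\<exists>b\<in>\<beta>. (a, b) \<in> r" if "a \<in> Field r" for a
      using xi[OF that] by (auto simp: \<beta>_def above_def Field_def)
    ultimately have "closed_cofinal r \<beta>" by (simp add: closed_cofinal_def)
    moreover have "\<exists>a\<in>Field r. g ` (\<beta> \<inter> aboveS r a) \<subseteq> U" if "x \<in> U" for U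
      using that ne by (auto simp: \<beta>_def)
    ultimately show ?thesis using gT[OF j(1)] j(2) by blast
  next
    case False
    then obtain i where i: "i \<in> Field r" "\<not> closedin X (g ` above r i)" by blast
    have "g ` above r i \<subseteq> topspace X" using gT aF by blast
    then obtain s :: "'c rel" and e where s: "noncompact_wo_space s"
      "continuous_map (wo_compactification s) X e"
      "e ` (Some ` Field s) \<subseteq> g ` above r i" "e None \<notin> g ` above r i"
      using sp i(2) unfolding strongly_pseudoradial_on_def by blast
    have "e None \<in> topspace X"
      using continuous_map_image_subset_topspace[OF s(2)] by auto
    then show ?thesis
      using closed_cofinal_limit_along_nonclosed_tail[OF N g(1,3) i(1) s] by metis
  qed
  then obtain \<beta> x where \<beta>: "closed_cofinal r \<beta>" and x: "x \<in> topspace X"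
    and lim: "\<And>U. openin X U \<Longrightarrow> x \<in> U \<Longrightarrow> \<exists>a\<in>Field r. g ` (\<beta> \<inter> aboveS r a) \<subseteq> U"
    by blast
  have "\<exists>a\<in>Field r. f ` (\<beta> \<inter> aboveS r a) \<subseteq> U" if U: "openin X U" "x \<in> U" for U
  proof -
    obtain a where a: "a \<in> Field r" "g ` (\<beta> \<inter> aboveS r a) \<subseteq> U" using lim[OF U] by blast
    have "f b \<in> U" if "b \<in> \<beta> \<inter> aboveS r a" for b
    proof -
      \<comment> \<open>An open set containing \<open>g b\<close> must contain \<open>f b\<close>,
        so the limit passes from \<open>g\<close> to \<open>f\<close> along the same
        \<open>\<beta>\<close>.\<close>
      have "g b \<in> X closure_of {f b}" using that g(2) by (auto simp: aboveS_def Field_def)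
      moreover have "g b \<in> U" using that a(2) by blast
      ultimately show ?thesis using U(1) by (auto simp: in_closure_of)
    qed
    then show ?thesis using a(1) by blast
  qed
  then show ?thesis using extendable_at_infinityI[OF N cf x] \<beta> by blast
qed

theorem theorem7p10:
  fixes X :: "'a topology"
  assumes "strongly_pseudoradial X"
  shows "decently_strongly_pseudoradially_compact X \<longleftrightarrow> decently_compact X"
proof
  assume "decently_strongly_pseudoradially_compact X"
  then show "decently_compact X"
    unfolding decently_strongly_pseudoradially_compact_def
      decently_strongly_pseudoradially_compact_on_def decently_compact_def decently_compact_on_def
    using extendable_at_infinity_cluster_point by blast
next
  assume "decently_compact X"
  then show "decently_strongly_pseudoradially_compact X"
    unfolding decently_strongly_pseudoradially_compact_def
      decently_strongly_pseudoradially_compact_on_def decently_compact_def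
    using assms decent_map_extendable unfolding strongly_pseudoradial_def by blast
qed

end
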